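(* Let $\Omega\subset\mathbb O^2$ be a domain. The sequence $$0\to \Gamma(\Omega,\mathcal V_0)\xrightarrow{\mathcal D_0}\Gamma(\Omega,\mathcal V_1)\xrightarrow{\mathcal D_1}\Gamma(\Omega,\mathcal V_2)\xrightarrow{\mathcal D_2}\Gamma(\Omega,\mathcal V_3)\xrightarrow{\mathcal D_3}\Gamma(\Omega,\mathcal V_4)\xrightarrow{\mathcal D_4}\Gamma(\Omega,\mathcal V_5)\to 0$$ is a differential complex, i.e. $\mathcal D_{j+1}\circ\mathcal D_j=0$ for $j=0,\dots,3$.
   Context: Octonions: $\mathbb O$ is the real octonion algebra with basis $e_0=1,e_1,\dots,e_7$, $e_a^2=-1$ and $e_ae_b=-e_be_a$ for $a\ne b$ in $\{1,\dots,7\}$; writing $\mathbb O=\mathbb H\oplus\mathbb H e_4$, the product is $(a,b)(c,d)=(ac-\bar d b,\,da+b\bar c)$. Conjugation: $\bar e_0=e_0$, $\bar e_a=-e_a$ for $a\ge1$. For $x=\sum_a x^ae_a$, $\operatorname{Re}x=x^0$, $\operatorname{Im}x=\sum_{a\ge1}x^ae_a$. $\mathcal H_2(\mathbb O)=\{\begin{pmatrix}a&q\\ \bar q&b\end{pmatrix}: a,b\in\mathbb R,\ q\in\mathbb O\}$, with entries written $u=(u_{\bar ij})_{i,j=1,2}$. Points of $\mathbb O^2\cong\mathbb R^{16}$ are $(x_1,x_2)$ with $x_j=\sum_{a=0}^7x_j^ae_a$. For an $\mathbb O$-valued function $F$, $$\partial_{\bar j}F=\sum_a e_a\frac{\partial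 F}{\partial x_j^a},\quad \partial_jF=\sum_a\bar e_a\frac{\partial F}{\partial x_j^a},\quad F\overleftarrow{\partial_{\bar j}}=\sum_a\frac{\partial F}{\partial x_j^a}e_a,\quad F\overleftarrow{\partial_j}=\sum_a\frac{\partial F}{\partial x_j^a}\bar e_a,$$ and $(\partial_{\bar i}\partial_j)F=\sum_{a,b}(e_a\bar e_b)\frac{\partial^2F}{\partial x_i^a\partial x_j^b}$; $\Delta_j=\sum_{a=0}^7\partial^2/\partial (x_j^a)^2$. $\mathcal V_0=\mathcal V_5=\mathbb R$, $\mathcal V_1=\mathcal V_4=\mathcal H_2(\mathbb O)$, $\mathcal V_2=\mathcal V_3=\mathbb O^2$; $\Gamma(\Omega,\mathcal V_j)$ denotes smooth $\mathcal V_j$-valued functions on $\Omega$. The operators are $$\mathcal D_0f=\begin{pmatrix}\Delta_1f&\partial_{\bar1}\partial_2f\\ \partial_{\bar2}\partial_1f&\Delta_2f\end{pmatrix},\qquad \mathcal D_1u=\begin{pmatrix}u_{\bar12}\overleftarrow{\partial_{\bar2}}-\partial_{\bar1}u_{\bar22}\\ u_{\bar21}\overleftarrow{\partial_{\bar1}}-\partial_{\bar2}u_{\bar11}\end{pmatrix},$$ $$\mathcal D_2v=\begin{pmatrix}(\partial_{\bar1}\partial_2)v_2-(\partial_{\bar1}\bar v_2)\overleftarrow{\partial_{\bar2}}+2\operatorname{Im}(v_1\overleftarrow{\partial_1})\overleftarrow{\partial_{\bar1}}\\ (\partial_{\bar2}\partial_1)v_1-(\partial_{\bar2}\bar v_1)\overleftarrow{\partial_{\bar1}}+2\operatorname{Im}(v_2\overleftarrow{\partial_2})\overleftarrow{\partial_{\bar2}}\end{pmatrix},$$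 $$\mathcal D_3t=\begin{pmatrix}\operatorname{Re}(\partial_2t_2)&-\frac{\partial_{\bar1}\bar t_2+t_1\overleftarrow{\partial_2}}2\\ -\frac{t_2\overleftarrow{\partial_1}+\partial_{\bar2}\bar t_1}2&\operatorname{Re}(\partial_1t_1)\end{pmatrix},\qquad \mathcal D_4s=\Delta_1s_{\bar11}+\Delta_2s_{\bar22}+2\operatorname{Re}(\partial_2s_{\bar21}\overleftarrow{\partial_{\bar1}}).$$ *)

theory Defs
  imports "HOL-Analysis.Analysis"
begin

section \<open>Octonions\<close>

text \<open>
  A quaternion is its coordinate tuple with respect to \<open>1, i, j, k\<close>, with Hamilton's product.
\<close>

type_synonym quat = "real \<times> real \<times> real \<times> real"

fun qmul :: "quat \<Rightarrow> quat \<Rightarrow> quat" where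
  "qmul (a0, a1, a2, a3) (b0, b1, b2, b3) =
     (a0 * b0 - a1 * b1 - a2 * b2 - a3 * b3,
      a0 * b1 + a1 * b0 + a2 * b3 - a3 * b2,
      a0 * b2 - a1 * b3 + a2 * b0 + a3 * b1,
      a0 * b3 + a1 * b2 - a2 * b1 + a3 * b0)"

fun qcnj :: "quat \<Rightarrow> quat" where
  "qcnj (a0, a1, a2, a3) = (a0, - a1, - a2, - a3)"

text \<open>
  The octonion \<open>\<Sum>a. x\<^sup>a e\<^sub>a\<close> is the vector whose coordinate \<open>x $ a\<close> is \<open>x\<^sup>a\<close>. The index type
  \<open>8\<close> consists of the eight elements \<open>0, \<dots>, 7\<close> (the integers modulo 8).

  Pitfall: the library operation \<open>*\<close> on \<open>real ^ 8\<close> is the coordinatewise product; the octonion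
  product is \<open>\<odot>\<close>, defined below by \<open>(a, b)(c, d) = (a c - qcnj d b, d a + b qcnj c)\<close> on
  \<open>\<bbbO> = \<bbbH> \<oplus> \<bbbH> e\<^sub>4\<close>. In particular \<open>e\<^sub>1 e\<^sub>2 = e\<^sub>3\<close>, and \<open>e\<^sub>5, e\<^sub>6, e\<^sub>7\<close> are the elements
  \<open>(0, i), (0, j), (0, k)\<close>.
\<close>

type_synonym octo = "real ^ 8"

definition oe :: "8 \<Rightarrow> octo" where
  "oe a = axis a 1"

definition quat_lo :: "octo \<Rightarrow> quat" where
  "quat_lo x = (x $ 0, x $ 1, x $ 2, x $ 3)"

definition quat_hi :: "octo \<Rightarrow> quat" where
  "quat_hi x = (x $ 4, x $ 5, x $ 6, x $ 7)"

fun octo_of_quats :: "quat \<Rightarrow> quat \<Rightarrow> octo" where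
  "octo_of_quats (a0, a1, a2, a3) (b0, b1, b2, b3) =
     a0 *\<^sub>R oe 0 + a1 *\<^sub>R oe 1 + a2 *\<^sub>R oe 2 + a3 *\<^sub>R oe 3 +
     b0 *\<^sub>R oe 4 + b1 *\<^sub>R oe 5 + b2 *\<^sub>R oe 6 + b3 *\<^sub>R oe 7"

definition omul :: "octo \<Rightarrow> octo \<Rightarrow> octo" (infixl "\<odot>" 70) where
  "x \<odot> y = octo_of_quats
     (qmul (quat_lo x) (quat_lo y) - qmul (qcnj (quat_hi y)) (quat_hi x))
     (qmul (quat_hi y) (quat_lo x) + qmul (quat_hi x) (qcnj (quat_lo y)))"

definition ocnj :: "octo \<Rightarrow> octo" where
  "ocnj x = (\<chi> a. if a = 0 then x $ a else - (x $ a))"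

definition oreal :: "real \<Rightarrow> octo" where
  "oreal r = r *\<^sub>R oe 0"

definition ore :: "octo \<Rightarrow> real" where
  "ore x = x $ 0"

definition oim :: "octo \<Rightarrow> octo" where
  "oim x = (\<chi> a. if a = 0 then 0 else x $ a)"

lemma octo_index_cases:
  fixes a :: 8
  shows "a = 0 \<or> a = 1 \<or> a = 2 \<or> a = 3 \<or> a = 4 \<or> a = 5 \<or> a = 6 \<or> a = 7"
proof (cases a)
  case (of_int z)
  then have "z \<in> {0, 1, 2, 3, 4, 5, 6, 7}" by auto
  with of_int show ?thesis by auto
qed

lemma quat_parts_oe:
  "quat_lo (oe 0) = (1, 0, 0, 0)" "quat_hi (oe 0) = 0"
  "quat_lo (oe 1) = (0, 1, 0, 0)" "quat_hi (oe 1) = 0"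
  "quat_lo (oe 2) = (0, 0, 1, 0)" "quat_hi (oe 2) = 0"
  "quat_lo (oe 3) = (0, 0, 0, 1)" "quat_hi (oe 3) = 0"
  "quat_lo (oe 4) = 0" "quat_hi (oe 4) = (1, 0, 0, 0)"
  "quat_lo (oe 5) = 0" "quat_hi (oe 5) = (0, 1, 0, 0)"
  "quat_lo (oe 6) = 0" "quat_hi (oe 6) = (0, 0, 1, 0)"
  "quat_lo (oe 7) = 0" "quat_hi (oe 7) = (0, 0, 0, 1)"
  by (simp_all add: quat_lo_def quat_hi_def oe_def axis_def zero_prod_def)

lemma omul_oe_one: "oe 0 \<odot> oe a = oe a" "oe a \<odot> oe 0 = oe a"
  using octo_index_cases[of a]
  by (elim disjE; simp add: omul_def quat_parts_oe zero_prod_def)+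

lemma omul_oe_square: "a \<noteq> 0 \<Longrightarrow> oe a \<odot> oe a = - oe 0"
  using octo_index_cases[of a]
  by (elim disjE) (simp_all add: omul_def quat_parts_oe zero_prod_def)

lemma omul_oe_anticommute:
  "a \<noteq> 0 \<Longrightarrow> b \<noteq> 0 \<Longrightarrow> a \<noteq> b \<Longrightarrow> oe a \<odot> oe b = - (oe b \<odot> oe a)"
  using octo_index_cases[of a] octo_index_cases[of b]
  by (elim disjE) (simp_all add: omul_def quat_parts_oe zero_prod_def)

text \<open>
  A point of \<open>\<bbbO>\<^sup>2\<close> is \<open>x\<close> with \<open>x\<^sub>j = x $ j\<close> for \<open>j = 1, 2\<close>, and the matrix entry
  \<open>u\<close> with index \<open>(i, j)\<close> is \<open>u $ i $ j\<close>.
\<close>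

definition herm2 :: "(octo ^ 2 ^ 2) set" where
  "herm2 = {vector [vector [oreal a, q], vector [ocnj q, oreal b]] | a b q. True}"


section \<open>Smooth functions and differential operators\<close>

text \<open>
  A function on a domain \<open>S\<close> is represented by a total function of which only the values on \<open>S\<close>
  matter; the definitions below are meant for open \<open>S\<close>.
\<close>

primrec Ck_on :: "nat \<Rightarrow> 'a::real_normed_vector set \<Rightarrow> ('a \<Rightarrow> 'b::real_normed_vector) \<Rightarrow> bool" where
  "Ck_on 0 S f \<longleftrightarrow> continuous_on S f"
| "Ck_on (Suc k) S f \<longleftrightarrow>
     (\<forall>x\<in>S. f differentiable (at x)) \<and> (\<forall>v. Ck_on k S (\<lambda>x. frechet_derivative f (at x) v))"

definition smooth_on :: "'a::real_normed_vector set \<Rightarrow> ('a \<Rightarrow> 'b::real_normed_vector) \<Rightarrow> bool" where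
  "smooth_on S f \<longleftrightarrow> (\<forall>k. Ck_on k S f)"

definition Gam :: "(octo ^ 2) set \<Rightarrow> 'b::real_normed_vector set \<Rightarrow> (octo ^ 2 \<Rightarrow> 'b) set" where
  "Gam \<Omega> V = {f. smooth_on \<Omega> f \<and> (\<forall>x\<in>\<Omega>. f x \<in> V)}"

text \<open>The partial derivative of \<open>F\<close> with respect to the real coordinate \<open>x\<^sub>j\<^sup>a\<close>.\<close>

definition pd :: "2 \<Rightarrow> 8 \<Rightarrow> (octo ^ 2 \<Rightarrow> 'b::real_normed_vector) \<Rightarrow> octo ^ 2 \<Rightarrow> 'b" where
  "pd j a F x = vector_derivative (\<lambda>t. F (x + t *\<^sub>R axis j (oe a))) (at 0)"

definition lap :: "2 \<Rightarrow> (octo ^ 2 \<Rightarrow> real) \<Rightarrow> octo ^ 2 \<Rightarrow> real" where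
  "lap j F x = (\<Sum>a\<in>UNIV. pd j a (pd j a F) x)"

text \<open>
  \<open>lbar j\<close> and \<open>ldel j\<close> are the operators with barred and unbarred index acting from the left;
  \<open>rbar j\<close> and \<open>rdel j\<close> are those acting from the right. In \<open>lbardel i j\<close> the two basis octonions
  are multiplied with each other first, so it is not the composition of \<open>lbar i\<close> and \<open>ldel j\<close>.
\<close>

definition lbar :: "2 \<Rightarrow> (octo ^ 2 \<Rightarrow> octo) \<Rightarrow> octo ^ 2 \<Rightarrow> octo" where
  "lbar j F x = (\<Sum>a\<in>UNIV. oe a \<odot> pd j a F x)"

definition ldel :: "2 \<Rightarrow> (octo ^ 2 \<Rightarrow> octo) \<Rightarrow> octo ^ 2 \<Rightarrow> octo" where
  "ldel j F x = (\<Sum>a\<in>UNIV. ocnj (oe a) \<odot> pd j a F x)"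

definition rbar :: "2 \<Rightarrow> (octo ^ 2 \<Rightarrow> octo) \<Rightarrow> octo ^ 2 \<Rightarrow> octo" where
  "rbar j F x = (\<Sum>a\<in>UNIV. pd j a F x \<odot> oe a)"

definition rdel :: "2 \<Rightarrow> (octo ^ 2 \<Rightarrow> octo) \<Rightarrow> octo ^ 2 \<Rightarrow> octo" where
  "rdel j F x = (\<Sum>a\<in>UNIV. pd j a F x \<odot> ocnj (oe a))"

definition lbardel :: "2 \<Rightarrow> 2 \<Rightarrow> (octo ^ 2 \<Rightarrow> octo) \<Rightarrow> octo ^ 2 \<Rightarrow> octo" where
  "lbardel i j F x = (\<Sum>a\<in>UNIV. \<Sum>b\<in>UNIV. (oe a \<odot> ocnj (oe b)) \<odot> pd i a (pd j b F) x)"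


section \<open>The operators of the complex\<close>

definition D0 :: "(octo ^ 2 \<Rightarrow> real) \<Rightarrow> octo ^ 2 \<Rightarrow> octo ^ 2 ^ 2" where
  "D0 f x = vector
     [vector [oreal (lap 1 f x), lbar 1 (ldel 2 (\<lambda>y. oreal (f y))) x],
      vector [lbar 2 (ldel 1 (\<lambda>y. oreal (f y))) x, oreal (lap 2 f x)]]"

definition D1 :: "(octo ^ 2 \<Rightarrow> octo ^ 2 ^ 2) \<Rightarrow> octo ^ 2 \<Rightarrow> octo ^ 2" where
  "D1 u x = vector
     [rbar 2 (\<lambda>y. u y $ 1 $ 2) x - lbar 1 (\<lambda>y. u y $ 2 $ 2) x,
      rbar 1 (\<lambda>y. u y $ 2 $ 1) x - lbar 2 (\<lambda>y. u y $ 1 $ 1) x]"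

definition D2 :: "(octo ^ 2 \<Rightarrow> octo ^ 2) \<Rightarrow> octo ^ 2 \<Rightarrow> octo ^ 2" where
  "D2 v x = vector
     [lbardel 1 2 (\<lambda>y. v y $ 2) x
        - rbar 2 (lbar 1 (\<lambda>y. ocnj (v y $ 2))) x
        + 2 *\<^sub>R rbar 1 (\<lambda>y. oim (rdel 1 (\<lambda>z. v z $ 1) y)) x,
      lbardel 2 1 (\<lambda>y. v y $ 1) x
        - rbar 1 (lbar 2 (\<lambda>y. ocnj (v y $ 1))) x
        + 2 *\<^sub>R rbar 2 (\<lambda>y. oim (rdel 2 (\<lambda>z. v z $ 2) y)) x]"

definition D3 :: "(octo ^ 2 \<Rightarrow> octo ^ 2) \<Rightarrow> octo ^ 2 \<Rightarrow> octo ^ 2 ^ 2" where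
  "D3 t x = vector
     [vector
        [oreal (ore (ldel 2 (\<lambda>y. t y $ 2) x)),
         - ((lbar 1 (\<lambda>y. ocnj (t y $ 2)) x + rdel 2 (\<lambda>y. t y $ 1) x) /\<^sub>R 2)],
      vector
        [- ((rdel 1 (\<lambda>y. t y $ 2) x + lbar 2 (\<lambda>y. ocnj (t y $ 1)) x) /\<^sub>R 2),
         oreal (ore (ldel 1 (\<lambda>y. t y $ 1) x))]]"

text \<open>
  The diagonal entries of an element of \<open>herm2\<close> are real octonions; \<open>ore\<close> turns them into reals.
\<close>

definition D4 :: "(octo ^ 2 \<Rightarrow> octo ^ 2 ^ 2) \<Rightarrow> octo ^ 2 \<Rightarrow> real" where
  "D4 s x = lap 1 (\<lambda>y. ore (s y $ 1 $ 1)) x + lap 2 (\<lambda>y. ore (s y $ 2 $ 2)) x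
     + 2 * ore (rbar 1 (ldel 2 (\<lambda>y. s y $ 2 $ 1)) x)"

end

theory Submission
  imports Defs
begin

text \<open>
  All five operators have constant coefficients, so each of them has a symbol: replacing the
  derivative with respect to \<open>x\<^sub>j\<^sup>a\<close> by a real variable \<open>\<xi>\<^sub>j\<^sup>a\<close> turns the operator into a map that is
  polynomial in \<open>\<xi> = (\<xi>\<^sub>1, \<xi>\<^sub>2) \<in> \<bbbO>\<^sup>2\<close> and linear in the value of the function. Under this
  replacement \<open>lbar j\<close> becomes left multiplication by \<open>\<xi>\<^sub>j\<close>, \<open>rdel j\<close> right multiplication by the
  conjugate of \<open>\<xi>\<^sub>j\<close>, and so on; the symbol of a composition is the composition of the symbols. The
  predicate \<open>has_symbol\<close> and its closure rules make this precise on an open set.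

  Iterated partial derivatives of a smooth function do not depend on the order of differentiation
  (\<open>pd_commute\<close>), so an operator sees only the part of its coefficients that is symmetric in the
  indices, and this part can be read off from the symbol. Hence an operator with zero symbol
  annihilates every smooth function (\<open>has_symbol_0_imp_eq_0\<close>), and \<open>\<D>\<^sub>j\<^sub>+\<^sub>1 \<D>\<^sub>j = 0\<close> reduces to an
  identity between octonions. With \<open>x = \<xi>\<^sub>1\<close> and \<open>y = \<xi>\<^sub>2\<close> these identities are:

  \<^item> for \<open>\<D>\<^sub>1 \<D>\<^sub>0\<close>, the cancellation law \<open>(x y\<^sup>*) y = |y|\<^sup>2 x\<close>;

  \<^item> for \<open>\<D>\<^sub>2 \<D>\<^sub>1\<close>, cancellation together with the middle Moufang identity
    \<open>(x y) (z x) = (x (y z)) x\<close>;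

  \<^item> for \<open>\<D>\<^sub>3 \<D>\<^sub>2\<close>, cancellation together with the left and the right Moufang identity in the
    off-diagonal entries, and the adjointness of multiplication by \<open>x\<close> and by \<open>x\<^sup>*\<close> on the diagonal;

  \<^item> for \<open>\<D>\<^sub>4 \<D>\<^sub>3\<close>, cancellation and \<open>Re ((x y) z) = Re (x (y z))\<close>.

  The same principle shows that \<open>\<D>\<^sub>0\<close> and \<open>\<D>\<^sub>3\<close> take values in the Hermitian matrices: their symbols
  are fixed by the linear projection \<open>herm_proj\<close> onto \<open>herm2\<close>. The identity for
  \<open>\<D>\<^sub>2 \<D>\<^sub>1\<close> concerns Hermitian matrices, so there the principle is applied to \<open>\<D>\<^sub>2 \<D>\<^sub>1\<close> preceded by this
  projection.
\<close>

section \<open>Octonion algebra\<close>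

lemma UNIV_octo_index: "(UNIV :: 8 set) = {0, 1, 2, 3, 4, 5, 6, 7}"
  using octo_index_cases by blast

lemma all_octo_index:
  "(\<forall>a::8. P a) \<longleftrightarrow> P 0 \<and> P 1 \<and> P 2 \<and> P 3 \<and> P 4 \<and> P 5 \<and> P 6 \<and> P 7"
proof -
  have "(\<forall>a::8. P a) \<longleftrightarrow> (\<forall>a\<in>UNIV. P a)"
    by simp
  then show ?thesis
    unfolding UNIV_octo_index by simp
qed

lemma octo_eq_iff:
  fixes x y :: octo
  shows "x = y \<longleftrightarrow> x $ 0 = y $ 0 \<and> x $ 1 = y $ 1 \<and> x $ 2 = y $ 2 \<and> x $ 3 = y $ 3
    \<and> x $ 4 = y $ 4 \<and> x $ 5 = y $ 5 \<and> x $ 6 = y $ 6 \<and> x $ 7 = y $ 7"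
  unfolding vec_eq_iff all_octo_index ..

lemma omul_nth:
  "(x \<odot> y) $ 0 = x$0 * y$0 - x$1 * y$1 - x$2 * y$2 - x$3 * y$3 - x$4 * y$4 - x$5 * y$5 - x$6 * y$6 - x$7 * y$7"
  "(x \<odot> y) $ 1 = x$0 * y$1 + x$1 * y$0 + x$2 * y$3 - x$3 * y$2 - x$5 * y$4 + x$4 * y$5 + x$7 * y$6 - x$6 * y$7"
  "(x \<odot> y) $ 2 = x$0 * y$2 - x$1 * y$3 + x$2 * y$0 + x$3 * y$1 - x$6 * y$4 + x$4 * y$6 - x$7 * y$5 + x$5 * y$7"
  "(x \<odot> y) $ 3 = x$0 * y$3 + x$1 * y$2 - x$2 * y$1 + x$3 * y$0 - x$7 * y$4 + x$4 * y$7 + x$6 * y$5 - x$5 * y$6"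
  "(x \<odot> y) $ 4 = x$0 * y$4 - x$1 * y$5 - x$2 * y$6 - x$3 * y$7 + x$4 * y$0 + x$5 * y$1 + x$6 * y$2 + x$7 * y$3"
  "(x \<odot> y) $ 5 = x$0 * y$5 + x$1 * y$4 - x$2 * y$7 + x$3 * y$6 + x$5 * y$0 - x$4 * y$1 - x$6 * y$3 + x$7 * y$2"
  "(x \<odot> y) $ 6 = x$0 * y$6 + x$1 * y$7 + x$2 * y$4 - x$3 * y$5 + x$6 * y$0 - x$4 * y$2 + x$5 * y$3 - x$7 * y$1"
  "(x \<odot> y) $ 7 = x$0 * y$7 - x$1 * y$6 + x$2 * y$5 + x$3 * y$4 + x$7 * y$0 - x$4 * y$3 - x$5 * y$2 + x$6 * y$1"
  by (simp_all add: omul_def quat_lo_def quat_hi_def oe_def axis_def)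

lemma ocnj_nth [simp]: "ocnj x $ a = (if a = 0 then x $ a else - (x $ a))"
  by (simp add: ocnj_def)

lemma oe_nth: "oe a $ b = (if a = b then 1 else 0)"
  by (auto simp: oe_def axis_def)

lemma sum_octo_index:
  "(\<Sum>a\<in>(UNIV :: 8 set). f a) = f 0 + f 1 + f 2 + f 3 + f 4 + f 5 + f 6 + (f 7 :: real)"
  unfolding UNIV_octo_index by simp

lemma octo_inner:
  fixes x y :: octo
  shows "x \<bullet> y = x$0 * y$0 + x$1 * y$1 + x$2 * y$2 + x$3 * y$3
    + x$4 * y$4 + x$5 * y$5 + x$6 * y$6 + x$7 * y$7"
  unfolding inner_vec_def sum_octo_index by simp

lemma bounded_bilinear_omul: "bounded_bilinear (\<odot>)"
proof -
  have "bilinear (\<odot>)"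
    unfolding bilinear_def
    by (auto intro!: linearI simp: octo_eq_iff omul_nth algebra_simps)
  then show ?thesis
    by (simp add: bilinear_conv_bounded_bilinear)
qed

interpretation omul: bounded_bilinear "(\<odot>)"
  by (rule bounded_bilinear_omul)

lemma linear_ocnj: "linear ocnj"
  by (rule linearI) (simp_all add: vec_eq_iff)

lemma bounded_linear_ocnj: "bounded_linear ocnj"
  using linear_ocnj by (simp add: linear_conv_bounded_linear)

lemma bounded_linear_oim: "bounded_linear oim"
  unfolding linear_conv_bounded_linear[symmetric]
  by (rule linearI) (simp_all add: vec_eq_iff oim_def)

lemma bounded_linear_ore: "bounded_linear ore"
  unfolding ore_def by (rule bounded_linear_vec_nth)

lemma bounded_linear_oreal: "bounded_linear oreal"
  unfolding oreal_def by (rule bounded_linear_scaleR_left)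

lemma omul_oreal: "x \<odot> oreal r = r *\<^sub>R x" "oreal r \<odot> x = r *\<^sub>R x"
  by (simp_all add: octo_eq_iff omul_nth oreal_def oe_nth)

lemma oim_eq: "2 *\<^sub>R oim x = x - ocnj x"
  by (simp add: octo_eq_iff oim_def)

lemma ocnj_eq: "ocnj x = oreal (2 * ore x) - x"
  by (simp add: octo_eq_iff oreal_def ore_def oe_nth)

lemma ocnj_ocnj [simp]: "ocnj (ocnj x) = x"
  by (simp add: vec_eq_iff)

lemma ocnj_oreal [simp]: "ocnj (oreal r) = oreal r"
  by (simp add: vec_eq_iff oreal_def oe_nth)

lemma ocnj_omul: "ocnj (x \<odot> y) = ocnj y \<odot> ocnj x"
  by (simp add: octo_eq_iff omul_nth)

lemma omul_ocnj: "x \<odot> ocnj x = oreal (x \<bullet> x)" "ocnj x \<odot> x = oreal (x \<bullet> x)"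
  by (simp_all add: octo_eq_iff omul_nth oreal_def oe_nth octo_inner)

text \<open>
  The associator of three octonions is purely imaginary.
\<close>

lemma ore_omul_assoc: "ore ((x \<odot> y) \<odot> z) = ore (x \<odot> (y \<odot> z))"
  unfolding ore_def omul_nth by algebra

text \<open>
  The alternative laws and flexibility are checked in coordinates. Everything below that concerns
  products of three or more octonions is deduced from them, since the Moufang identities are of
  degree four and their coordinate expansions are very large.
\<close>

lemma omul_left_alternative: "x \<odot> (x \<odot> y) = (x \<odot> x) \<odot> y"
  unfolding octo_eq_iff omul_nth by (intro conjI; algebra)

lemma omul_right_alternative: "(y \<odot> x) \<odot> x = y \<odot> (x \<odot> x)"
  unfolding octo_eq_iff omul_nth by (intro conjI; algebra)

lemma omul_flexible: "(x \<odot> y) \<odot> x = x \<odot> (y \<odot> x)"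
  unfolding octo_eq_iff omul_nth by (intro conjI; algebra)

text \<open>
  Polarization of the alternative laws: the associator \<open>(x y) z - x (y z)\<close> changes sign when two
  neighbouring arguments are exchanged. Both laws are written as rules for moving the brackets of
  \<open>(x y) z\<close> to the right, at the price of an exchanged pair.
\<close>

lemma omul_left_alternative_linearized:
  "(x \<odot> y) \<odot> z = x \<odot> (y \<odot> z) + y \<odot> (x \<odot> z) - (y \<odot> x) \<odot> z"
  using omul_left_alternative[of "x + y" z] omul_left_alternative[of x z] omul_left_alternative[of y z]
  by (simp add: omul.add_left omul.add_right algebra_simps)

lemma omul_right_alternative_linearized:
  "(x \<odot> y) \<odot> z = x \<odot> (y \<odot> z) + x \<odot> (z \<odot> y) - (x \<odot> z) \<odot> y"
  using omul_right_alternative[of x "y + z"] omul_right_alternative[of x y] omul_right_alternative[of x z]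
  by (simp add: omul.add_left omul.add_right algebra_simps)

text \<open>
  Write \<open>[a, b, c]\<close> for the associator. The difference of the two sides is \<open>[x y, x, z] + [x, y, x z]\<close>,
  which is \<open>- [x, x y, z] - [x, x z, y]\<close> by the polarized laws. After these two associators
  are expanded and \<open>x (x y)\<close>, \<open>x (x z)\<close> are rewritten by left alternativity, the terms cancel by the
  polarized right alternative law.
\<close>

lemma omul_left_moufang: "((x \<odot> y) \<odot> x) \<odot> z = x \<odot> (y \<odot> (x \<odot> z))"
proof -
  have "((x \<odot> y) \<odot> x) \<odot> z
      = (x \<odot> y) \<odot> (x \<odot> z) + x \<odot> ((x \<odot> y) \<odot> z) - (x \<odot> (x \<odot> y)) \<odot> z"
    by (rule omul_left_alternative_linearized)
  moreover have "(x \<odot> y) \<odot> (x \<odot> z)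
      = x \<odot> (y \<odot> (x \<odot> z)) + x \<odot> ((x \<odot> z) \<odot> y) - (x \<odot> (x \<odot> z)) \<odot> y"
    by (rule omul_right_alternative_linearized)
  moreover have "((x \<odot> x) \<odot> y) \<odot> z
      = (x \<odot> x) \<odot> (y \<odot> z) + (x \<odot> x) \<odot> (z \<odot> y) - ((x \<odot> x) \<odot> z) \<odot> y"
    by (rule omul_right_alternative_linearized)
  moreover have "x \<odot> ((x \<odot> y) \<odot> z)
      = x \<odot> (x \<odot> (y \<odot> z)) + x \<odot> (x \<odot> (z \<odot> y)) - x \<odot> ((x \<odot> z) \<odot> y)"
    by (subst omul_right_alternative_linearized) (simp add: omul.add_right omul.diff_right)
  ultimately show ?thesis
    by (simp add: omul_left_alternative)
qed

text \<open>
  Conjugation reverses products, and so exchanges the two outer Moufang identities.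
\<close>

lemma omul_right_moufang: "((z \<odot> x) \<odot> y) \<odot> x = z \<odot> (x \<odot> (y \<odot> x))"
proof -
  have "ocnj (((z \<odot> x) \<odot> y) \<odot> x) = ocnj (z \<odot> (x \<odot> (y \<odot> x)))"
    by (simp add: ocnj_omul omul_left_moufang)
  then show ?thesis
    by (metis ocnj_ocnj)
qed

text \<open>
  Moving the brackets of \<open>(x y) (z x)\<close> to the right produces a common factor \<open>x\<close> on the left, by the
  left Moufang identity; the remaining factor is \<open>(y z) x\<close> because associators are invariant under
  cyclic permutations.
\<close>

lemma omul_middle_moufang: "(x \<odot> y) \<odot> (z \<odot> x) = (x \<odot> (y \<odot> z)) \<odot> x"
proof -
  have "(x \<odot> y) \<odot> (z \<odot> x)
      = x \<odot> (y \<odot> (z \<odot> x)) + x \<odot> ((z \<odot> x) \<odot> y) - (x \<odot> (z \<odot> x)) \<odot> y"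
    by (rule omul_right_alternative_linearized)
  also have "(x \<odot> (z \<odot> x)) \<odot> y = x \<odot> (z \<odot> (x \<odot> y))"
    by (simp add: omul_left_moufang flip: omul_flexible)
  also have "x \<odot> (y \<odot> (z \<odot> x)) + x \<odot> ((z \<odot> x) \<odot> y) - x \<odot> (z \<odot> (x \<odot> y))
      = x \<odot> (y \<odot> (z \<odot> x) + (z \<odot> x) \<odot> y - z \<odot> (x \<odot> y))"
    by (simp add: omul.add_right omul.diff_right)
  also have "y \<odot> (z \<odot> x) + (z \<odot> x) \<odot> y - z \<odot> (x \<odot> y) = (y \<odot> z) \<odot> x"
    unfolding omul_right_alternative_linearized[of z x y] omul_left_alternative_linearized[of y z x]
    by (simp add: algebra_simps)
  finally show ?thesis
    by (simp add: omul_flexible)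
qed

text \<open>
  Since \<open>ocnj x\<close> differs from \<open>- x\<close> by a real number, alternativity lets \<open>x\<close> and \<open>ocnj x\<close> associate with
  any octonion. The squares that arise are eliminated by \<open>x\<^sup>2 = 2 Re x x - |x|\<^sup>2\<close>.
\<close>

lemma omul_ocnj_cancel:
  "x \<odot> (ocnj x \<odot> y) = (x \<bullet> x) *\<^sub>R y"
  "ocnj x \<odot> (x \<odot> y) = (x \<bullet> x) *\<^sub>R y"
  "(y \<odot> x) \<odot> ocnj x = (x \<bullet> x) *\<^sub>R y"
  "(y \<odot> ocnj x) \<odot> x = (x \<bullet> x) *\<^sub>R y"
proof -
  have sq: "x \<odot> x = (2 * ore x) *\<^sub>R x - oreal (x \<bullet> x)"
    using omul_ocnj(1)[of x] by (simp add: ocnj_eq omul.diff_right omul_oreal algebra_simps)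
  show "x \<odot> (ocnj x \<odot> y) = (x \<bullet> x) *\<^sub>R y" "ocnj x \<odot> (x \<odot> y) = (x \<bullet> x) *\<^sub>R y"
    "(y \<odot> x) \<odot> ocnj x = (x \<bullet> x) *\<^sub>R y" "(y \<odot> ocnj x) \<odot> x = (x \<bullet> x) *\<^sub>R y"
    by (simp_all add: ocnj_eq omul.diff_left omul.diff_right omul_oreal omul_left_alternative
        omul_right_alternative sq omul.scaleR_left omul.scaleR_right)
qed

lemma sum_oe: "(\<Sum>a\<in>UNIV. x $ a *\<^sub>R oe a) = x"
  using basis_expansion[of x] by (simp add: oe_def scalar_mult_eq_scaleR)

text \<open>
  Read from left to right, these compute the symbols of \<open>lbar\<close>, \<open>ldel\<close>, \<open>rbar\<close> and \<open>rdel\<close>: the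
  coordinates of \<open>x\<close> stand for the partial derivatives.
\<close>

lemma sum_oe_omul:
  "(\<Sum>a\<in>UNIV. oe a \<odot> (x $ a *\<^sub>R y)) = x \<odot> y"
  "(\<Sum>a\<in>UNIV. ocnj (oe a) \<odot> (x $ a *\<^sub>R y)) = ocnj x \<odot> y"
  "(\<Sum>a\<in>UNIV. (x $ a *\<^sub>R y) \<odot> oe a) = y \<odot> x"
  "(\<Sum>a\<in>UNIV. (x $ a *\<^sub>R y) \<odot> ocnj (oe a)) = y \<odot> ocnj x"
proof -
  have cnj: "(\<Sum>a\<in>UNIV. x $ a *\<^sub>R ocnj (oe a)) = ocnj x"
    using arg_cong[OF sum_oe[of x], of ocnj]
    by (simp add: linear_sum[OF linear_ocnj] linear_cmul[OF linear_ocnj])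
  have pull: "oe a \<odot> (r *\<^sub>R y) = (r *\<^sub>R oe a) \<odot> y" "z \<odot> (r *\<^sub>R y) = (r *\<^sub>R z) \<odot> y"
    "(r *\<^sub>R y) \<odot> z = y \<odot> (r *\<^sub>R z)" for a r z
    by (simp_all add: omul.scaleR_left omul.scaleR_right)
  show "(\<Sum>a\<in>UNIV. oe a \<odot> (x $ a *\<^sub>R y)) = x \<odot> y"
    "(\<Sum>a\<in>UNIV. ocnj (oe a) \<odot> (x $ a *\<^sub>R y)) = ocnj x \<odot> y"
    "(\<Sum>a\<in>UNIV. (x $ a *\<^sub>R y) \<odot> oe a) = y \<odot> x"
    "(\<Sum>a\<in>UNIV. (x $ a *\<^sub>R y) \<odot> ocnj (oe a)) = y \<odot> ocnj x"
    unfolding pull omul.sum_left[symmetric] omul.sum_right[symmetric] sum_oe cnj by (rule refl)+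
qed

lemma ore_ocnj_omul: "ore (ocnj x \<odot> y) = x \<bullet> y"
  by (simp add: ore_def omul_nth octo_inner)

text \<open>
  Multiplication by \<open>ocnj x\<close> is adjoint to multiplication by \<open>x\<close>, so that \<open>x\<close> can be cancelled.
\<close>

lemma inner_omul_omul: "x \<bullet> ((x \<odot> y) \<odot> z) = (x \<bullet> x) * (ocnj y \<bullet> z)"
proof -
  have "x \<bullet> ((x \<odot> y) \<odot> z) = ore ((ocnj x \<odot> (x \<odot> y)) \<odot> z)"
    by (simp add: ore_omul_assoc ore_ocnj_omul)
  also have "\<dots> = (x \<bullet> x) * ore (ocnj (ocnj y) \<odot> z)"
    by (simp add: omul_ocnj_cancel omul.scaleR_left ore_def)
  finally show ?thesis
    unfolding ore_ocnj_omul .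
qed

section \<open>The symbol complex\<close>

text \<open>
  The linear projection onto \<open>herm2\<close> that keeps the upper right entry and the real parts on the
  diagonal.
\<close>

definition herm_proj :: "octo ^ 2 ^ 2 \<Rightarrow> octo ^ 2 ^ 2" where
  "herm_proj u = vector
     [vector [oreal (ore (u $ 1 $ 1)), u $ 1 $ 2],
      vector [ocnj (u $ 1 $ 2), oreal (ore (u $ 2 $ 2))]]"

text \<open>
  The symbol of each operator, at the covector \<open>\<xi>\<close>. They are written with the same bracketing as the
  operators, so that \<open>has_symbol_D0\<close> to \<open>has_symbol_D4\<close> can be proved by structural rules.
\<close>

definition symbol_D0 :: "octo ^ 2 \<Rightarrow> real \<Rightarrow> octo ^ 2 ^ 2" where
  "symbol_D0 \<xi> f = vector
     [vector [oreal ((\<xi> $ 1 \<bullet> \<xi> $ 1) * f), \<xi> $ 1 \<odot> (ocnj (\<xi> $ 2) \<odot> oreal f)],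
      vector [\<xi> $ 2 \<odot> (ocnj (\<xi> $ 1) \<odot> oreal f), oreal ((\<xi> $ 2 \<bullet> \<xi> $ 2) * f)]]"

definition symbol_D1 :: "octo ^ 2 \<Rightarrow> octo ^ 2 ^ 2 \<Rightarrow> octo ^ 2" where
  "symbol_D1 \<xi> u = vector
     [u $ 1 $ 2 \<odot> \<xi> $ 2 - \<xi> $ 1 \<odot> u $ 2 $ 2,
      u $ 2 $ 1 \<odot> \<xi> $ 1 - \<xi> $ 2 \<odot> u $ 1 $ 1]"

definition symbol_D2 :: "octo ^ 2 \<Rightarrow> octo ^ 2 \<Rightarrow> octo ^ 2" where
  "symbol_D2 \<xi> v = vector
     [(\<xi> $ 1 \<odot> ocnj (\<xi> $ 2)) \<odot> v $ 2 - (\<xi> $ 1 \<odot> ocnj (v $ 2)) \<odot> \<xi> $ 2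
        + 2 *\<^sub>R (oim (v $ 1 \<odot> ocnj (\<xi> $ 1)) \<odot> \<xi> $ 1),
      (\<xi> $ 2 \<odot> ocnj (\<xi> $ 1)) \<odot> v $ 1 - (\<xi> $ 2 \<odot> ocnj (v $ 1)) \<odot> \<xi> $ 1
        + 2 *\<^sub>R (oim (v $ 2 \<odot> ocnj (\<xi> $ 2)) \<odot> \<xi> $ 2)]"

definition symbol_D3 :: "octo ^ 2 \<Rightarrow> octo ^ 2 \<Rightarrow> octo ^ 2 ^ 2" where
  "symbol_D3 \<xi> t = vector
     [vector
        [oreal (ore (ocnj (\<xi> $ 2) \<odot> t $ 2)),
         - ((\<xi> $ 1 \<odot> ocnj (t $ 2) + t $ 1 \<odot> ocnj (\<xi> $ 2)) /\<^sub>R 2)],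
      vector
        [- ((t $ 2 \<odot> ocnj (\<xi> $ 1) + \<xi> $ 2 \<odot> ocnj (t $ 1)) /\<^sub>R 2),
         oreal (ore (ocnj (\<xi> $ 1) \<odot> t $ 1))]]"

definition symbol_D4 :: "octo ^ 2 \<Rightarrow> octo ^ 2 ^ 2 \<Rightarrow> real" where
  "symbol_D4 \<xi> s = (\<xi> $ 1 \<bullet> \<xi> $ 1) * ore (s $ 1 $ 1) + (\<xi> $ 2 \<bullet> \<xi> $ 2) * ore (s $ 2 $ 2)
     + 2 * ore ((ocnj (\<xi> $ 2) \<odot> s $ 2 $ 1) \<odot> \<xi> $ 1)"

lemma ore_oreal [simp]: "ore (oreal r) = r"
  by (simp add: ore_def oreal_def oe_nth)

lemma herm2_iff_herm_proj: "u \<in> herm2 \<longleftrightarrow> u = herm_proj u"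
proof
  assume "u \<in> herm2"
  then show "u = herm_proj u"
    by (auto simp: herm2_def herm_proj_def)
qed (auto simp: herm2_def herm_proj_def)

lemma herm_proj_symbol_D0: "herm_proj (symbol_D0 \<xi> f) = symbol_D0 \<xi> f"
  by (simp add: herm_proj_def symbol_D0_def ocnj_omul omul_oreal linear_cmul[OF linear_ocnj] omul.scaleR_right)

lemma herm_proj_symbol_D3: "herm_proj (symbol_D3 \<xi> t) = symbol_D3 \<xi> t"
  by (simp add: herm_proj_def symbol_D3_def ocnj_omul linear_cmul[OF linear_ocnj] linear_add[OF linear_ocnj]
      linear_neg[OF linear_ocnj] add.commute)

lemma symbol_D1_symbol_D0: "symbol_D1 \<xi> (symbol_D0 \<xi> f) = 0"
  by (simp add: symbol_D1_def symbol_D0_def omul_oreal omul.scaleR_left omul.scaleR_right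
      omul_ocnj_cancel mult.commute vec_eq_iff forall_2)

text \<open>
  The imaginary part in \<open>symbol_D2\<close> is half the difference of an octonion and its conjugate; the first
  half then cancels.
\<close>

lemma scaleR_oim_omul: "2 *\<^sub>R (oim (v \<odot> ocnj x) \<odot> x) = (x \<bullet> x) *\<^sub>R v - (x \<odot> ocnj v) \<odot> x"
proof -
  have "2 *\<^sub>R (oim (v \<odot> ocnj x) \<odot> x) = (2 *\<^sub>R oim (v \<odot> ocnj x)) \<odot> x"
    by (simp add: omul.scaleR_left)
  also have "\<dots> = (x \<bullet> x) *\<^sub>R v - (x \<odot> ocnj v) \<odot> x"
    by (simp add: oim_eq ocnj_omul omul.diff_left omul_ocnj_cancel)
  finally show ?thesis .
qed

lemma symbol_D2_nth:
  "symbol_D2 \<xi> v $ 1 = (\<xi> $ 1 \<odot> ocnj (\<xi> $ 2)) \<odot> v $ 2 - (\<xi> $ 1 \<odot> ocnj (v $ 2)) \<odot> \<xi> $ 2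
     + ((\<xi> $ 1 \<bullet> \<xi> $ 1) *\<^sub>R v $ 1 - (\<xi> $ 1 \<odot> ocnj (v $ 1)) \<odot> \<xi> $ 1)"
  "symbol_D2 \<xi> v $ 2 = (\<xi> $ 2 \<odot> ocnj (\<xi> $ 1)) \<odot> v $ 1 - (\<xi> $ 2 \<odot> ocnj (v $ 1)) \<odot> \<xi> $ 1
     + ((\<xi> $ 2 \<bullet> \<xi> $ 2) *\<^sub>R v $ 2 - (\<xi> $ 2 \<odot> ocnj (v $ 2)) \<odot> \<xi> $ 2)"
  by (simp_all add: symbol_D2_def scaleR_oim_omul)

text \<open>
  The diagonal entries of a Hermitian matrix are real and drop out by cancellation. The entry \<open>q\<close>
  with \<open>q = u $ 1 $ 2\<close> contributes \<open>(x y\<^sup>*) (q\<^sup>* x) - (x (q y)\<^sup>*) x\<close> to the first component, which is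
  zero by the middle Moufang identity, and the second component is analogous.
\<close>

lemma symbol_D2_symbol_D1: "symbol_D2 \<xi> (symbol_D1 \<xi> (herm_proj u)) = 0"
  by (simp add: vec_eq_iff[of "symbol_D2 _ _"] forall_2 symbol_D2_nth symbol_D1_def herm_proj_def
      omul_oreal ocnj_omul linear_diff[OF linear_ocnj] linear_cmul[OF linear_ocnj] omul.diff_left
      omul.diff_right omul.scaleR_left omul.scaleR_right omul_ocnj_cancel omul_middle_moufang
      omul_ocnj algebra_simps)

text \<open>
  On the diagonal, pairing with \<open>x\<close> or \<open>y\<close> turns each term of \<open>t\<close> into a multiple of an inner product of
  \<open>v\<close> with \<open>x\<close> or \<open>y\<close>, and these cancel in pairs. In the upper right entry, \<open>v\<^sub>1\<close> contributes
  \<open>x (v\<^sub>1\<^sup>* (x y\<^sup>*)) - ((x v\<^sub>1\<^sup>*) x) y\<^sup>*\<close>, which vanishes by the left Moufang identity, and \<open>v\<^sub>2\<close> contributes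
  a difference that vanishes by the right one; all other terms cancel. The lower left entry is
  obtained by exchanging the indices.
\<close>

lemma symbol_D3_symbol_D2: "symbol_D3 \<xi> (symbol_D2 \<xi> v) = 0"
proof -
  define x y t where "x = \<xi> $ 1" and "y = \<xi> $ 2" and "t = symbol_D2 \<xi> v"
  have t: "t $ 1 = (x \<odot> ocnj y) \<odot> v $ 2 - (x \<odot> ocnj (v $ 2)) \<odot> y
      + ((x \<bullet> x) *\<^sub>R v $ 1 - (x \<odot> ocnj (v $ 1)) \<odot> x)"
    "t $ 2 = (y \<odot> ocnj x) \<odot> v $ 1 - (y \<odot> ocnj (v $ 1)) \<odot> x
      + ((y \<bullet> y) *\<^sub>R v $ 2 - (y \<odot> ocnj (v $ 2)) \<odot> y)"
    unfolding t_def x_def y_def by (rule symbol_D2_nth)+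
  note lin = linear_diff[OF linear_ocnj] linear_add[OF linear_ocnj] linear_cmul[OF linear_ocnj]
    omul.add_left omul.add_right omul.diff_left omul.diff_right omul.scaleR_left omul.scaleR_right
  have "ore (ocnj x \<odot> t $ 1) = 0" "ore (ocnj y \<odot> t $ 2) = 0"
    unfolding t ore_ocnj_omul
    by (simp_all add: inner_add_right inner_diff_right inner_omul_omul inner_commute algebra_simps)
  moreover have "x \<odot> ocnj (t $ 2) + t $ 1 \<odot> ocnj y = 0" "t $ 2 \<odot> ocnj x + y \<odot> ocnj (t $ 1) = 0"
    unfolding t by (simp_all add: lin ocnj_omul omul_ocnj_cancel omul_left_moufang omul_right_moufang)
  ultimately have "symbol_D3 \<xi> t = 0"
    by (simp add: symbol_D3_def x_def y_def vec_eq_iff[of "vector _"] forall_2 oreal_def)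
  then show ?thesis
    by (simp add: t_def)
qed

text \<open>
  The real part does not see the bracketing, so in each half of the off-diagonal entry a covector
  component meets its conjugate and cancels. What remains are the two diagonal terms with the
  opposite sign.
\<close>

lemma symbol_D4_symbol_D3: "symbol_D4 \<xi> (symbol_D3 \<xi> t) = 0"
proof -
  define x y where "x = \<xi> $ 1" and "y = \<xi> $ 2"
  have "ore ((ocnj y \<odot> (t $ 2 \<odot> ocnj x)) \<odot> x) = (x \<bullet> x) * ore (ocnj y \<odot> t $ 2)"
    by (simp add: ore_omul_assoc omul_ocnj_cancel omul.scaleR_right) (simp add: ore_def)
  moreover have "ore ((ocnj y \<odot> (y \<odot> ocnj (t $ 1))) \<odot> x) = (y \<bullet> y) * ore (ocnj (t $ 1) \<odot> x)"
    by (simp add: omul_ocnj_cancel omul.scaleR_left) (simp add: ore_def)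
  moreover have "ore (ocnj (t $ 1) \<odot> x) = ore (ocnj x \<odot> t $ 1)"
    by (simp add: ore_ocnj_omul inner_commute)
  ultimately show ?thesis
    by (simp add: symbol_D4_def symbol_D3_def x_def y_def omul.add_left omul.add_right
        omul.scaleR_left omul.scaleR_right omul.minus_left omul.minus_right)
      (simp add: ore_def)
qed

section \<open>Smooth functions and partial derivatives\<close>

lemmas frechet_derivative_worksI = iffD1[OF frechet_derivative_works]

text \<open>
  Differentiability at a point of an open set depends only on the values on that set. This is needed
  throughout, since the functions are controlled only on their domain.
\<close>

lemma frechet_derivative_cong_on:
  assumes "open S" "x \<in> S" "\<And>y. y \<in> S \<Longrightarrow> f y = g y" "f differentiable (at x)"
  shows "g differentiable (at x)" "frechet_derivative g (at x) = frechet_derivative f (at x)"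
proof -
  have "(g has_derivative frechet_derivative f (at x)) (at x)"
    using has_derivative_transform_within_open[OF frechet_derivative_worksI[OF assms(4)] assms(1,2)]
      assms(3) by blast
  then show "g differentiable (at x)" "frechet_derivative g (at x) = frechet_derivative f (at x)"
    by (auto simp: differentiable_def dest: frechet_derivative_at)
qed

lemma Ck_on_cong:
  assumes "open S" "\<And>x. x \<in> S \<Longrightarrow> f x = g x" "Ck_on k S f"
  shows "Ck_on k S g"
  using assms(2,3)
proof (induction k arbitrary: f g)
  case 0
  then show ?case
    by (simp cong: continuous_on_cong)
next
  case (Suc k)
  have "g differentiable (at x)" "frechet_derivative g (at x) = frechet_derivative f (at x)"
    if "x \<in> S" for x
    using frechet_derivative_cong_on[OF assms(1) that, of f g] Suc.prems that by auto
  then show ?case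
    using Suc.IH[of "\<lambda>x. frechet_derivative f (at x) v" "\<lambda>x. frechet_derivative g (at x) v" for v]
      Suc.prems(2) by auto
qed

lemma Ck_on_bounded_linear:
  assumes "open S" "bounded_linear L" "Ck_on k S f"
  shows "Ck_on k S (\<lambda>x. L (f x))"
  using assms(3)
proof (induction k arbitrary: f)
  case 0
  then show ?case
    using bounded_linear.continuous_on[OF assms(2)] by simp
next
  case (Suc k)
  have *: "((\<lambda>x. L (f x)) has_derivative (\<lambda>v. L (frechet_derivative f (at x) v))) (at x)"
    if "x \<in> S" for x
    by (rule bounded_linear.has_derivative[OF assms(2) frechet_derivative_worksI])
      (use Suc.prems that in simp)
  have "Ck_on k S (\<lambda>x. frechet_derivative (\<lambda>y. L (f y)) (at x) v)" for v
    by (rule Ck_on_cong[OF assms(1) _ Suc.IH[of "\<lambda>x. frechet_derivative f (at x) v"]])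
      (use Suc.prems frechet_derivative_at[OF *, symmetric] in auto)
  then show ?case
    using * by (auto simp: differentiable_def)
qed

lemma Ck_on_add:
  assumes "open S" "Ck_on k S f" "Ck_on k S g"
  shows "Ck_on k S (\<lambda>x. f x + g x)"
  using assms(2,3)
proof (induction k arbitrary: f g)
  case 0
  then show ?case
    by (simp add: continuous_on_add)
next
  case (Suc k)
  have *: "((\<lambda>x. f x + g x) has_derivative
      (\<lambda>v. frechet_derivative f (at x) v + frechet_derivative g (at x) v)) (at x)"
    if "x \<in> S" for x
    by (rule has_derivative_add[OF frechet_derivative_worksI frechet_derivative_worksI])
      (use Suc.prems that in simp_all)
  have "Ck_on k S (\<lambda>x. frechet_derivative (\<lambda>y. f y + g y) (at x) v)" for v
    by (rule Ck_on_cong[OF assms(1) _ Suc.IH[of "\<lambda>x. frechet_derivative f (at x) v"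
            "\<lambda>x. frechet_derivative g (at x) v"]])
      (use Suc.prems frechet_derivative_at[OF *, symmetric] in auto)
  then show ?case
    using * by (auto simp: differentiable_def)
qed

lemma Ck_on_zero: "Ck_on k S (\<lambda>x. 0)"
  by (induction k) simp_all

lemma smooth_on_cong:
  assumes "open S" "\<And>x. x \<in> S \<Longrightarrow> f x = g x" "smooth_on S f"
  shows "smooth_on S g"
  using assms(3) Ck_on_cong[of S f g, OF assms(1,2)] unfolding smooth_on_def by blast

lemma smooth_on_bounded_linear:
  "open S \<Longrightarrow> bounded_linear L \<Longrightarrow> smooth_on S f \<Longrightarrow> smooth_on S (\<lambda>x. L (f x))"
  by (simp add: smooth_on_def Ck_on_bounded_linear)

lemma smooth_on_sum:
  assumes "open S" "\<And>i. i \<in> I \<Longrightarrow> smooth_on S (f i)"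
  shows "smooth_on S (\<lambda>x. \<Sum>i\<in>I. f i x)"
  using assms(2)
proof (induction I rule: infinite_finite_induct)
  case (insert i I)
  then show ?case
    by (simp add: smooth_on_def Ck_on_add[OF assms(1)])
qed (simp_all add: smooth_on_def Ck_on_zero)

lemma smooth_on_differentiable: "smooth_on S f \<Longrightarrow> x \<in> S \<Longrightarrow> f differentiable (at x)"
  unfolding smooth_on_def by (metis Ck_on.simps(2))

lemma smooth_on_continuous_on: "smooth_on S f \<Longrightarrow> continuous_on S f"
  unfolding smooth_on_def by (metis Ck_on.simps(1))

text \<open>
  The partial derivative \<open>pd\<close> is defined along a line, smoothness by total derivatives; the chain rule
  connects them, at every point of the line.
\<close>

lemma has_vector_derivative_along_line:
  assumes "F differentiable (at (x + t *\<^sub>R axis j (oe a)))"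
  shows "((\<lambda>s. F (x + s *\<^sub>R axis j (oe a))) has_vector_derivative
    frechet_derivative F (at (x + t *\<^sub>R axis j (oe a))) (axis j (oe a))) (at t)"
proof -
  have "((\<lambda>s. x + s *\<^sub>R axis j (oe a)) has_derivative (\<lambda>s. s *\<^sub>R axis j (oe a))) (at t)"
    by (auto intro!: derivative_eq_intros)
  from diff_chain_at[OF this frechet_derivative_worksI[OF assms]]
  have "((\<lambda>s. F (x + s *\<^sub>R axis j (oe a))) has_derivative
      (\<lambda>s. frechet_derivative F (at (x + t *\<^sub>R axis j (oe a))) (s *\<^sub>R axis j (oe a)))) (at t)"
    by (simp add: o_def)
  then show ?thesis
    using linear_frechet_derivative[OF assms]
    by (simp add: has_vector_derivative_def linear_cmul)
qed

lemma pd_eq_frechet_derivative: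
  "F differentiable (at x) \<Longrightarrow> pd j a F x = frechet_derivative F (at x) (axis j (oe a))"
  using has_vector_derivative_along_line[of F x 0 j a]
  by (auto simp: pd_def intro: vector_derivative_at)

lemma smooth_on_pd:
  assumes "open S" "smooth_on S F"
  shows "smooth_on S (pd j a F)"
proof (rule smooth_on_cong[OF assms(1)])
  show "smooth_on S (\<lambda>x. frechet_derivative F (at x) (axis j (oe a)))"
    using assms(2) unfolding smooth_on_def by (metis Ck_on.simps(2))
qed (simp add: pd_eq_frechet_derivative smooth_on_differentiable[OF assms(2)])

lemma pd_cong_on:
  assumes "open S" "x \<in> S" "\<And>y. y \<in> S \<Longrightarrow> F y = G y" "smooth_on S F"
  shows "pd j a F x = pd j a G x"
  using frechet_derivative_cong_on[of S x F G] smooth_on_differentiable[OF assms(4,2)] assms(1-3)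
  by (simp add: pd_eq_frechet_derivative)

lemma pd_bounded_linear:
  assumes "bounded_linear L" "F differentiable (at x)"
  shows "pd j a (\<lambda>y. L (F y)) x = L (pd j a F x)"
proof -
  have *: "((\<lambda>y. L (F y)) has_derivative (\<lambda>v. L (frechet_derivative F (at x) v))) (at x)"
    by (rule bounded_linear.has_derivative[OF assms(1) frechet_derivative_worksI[OF assms(2)]])
  then have "(\<lambda>y. L (F y)) differentiable (at x)"
    by (auto simp: differentiable_def)
  then show ?thesis
    using assms(2) frechet_derivative_at[OF *, symmetric] by (simp add: pd_eq_frechet_derivative)
qed

lemma pd_sum:
  assumes "\<And>i. i \<in> I \<Longrightarrow> F i differentiable (at x)"
  shows "pd j a (\<lambda>y. \<Sum>i\<in>I. F i y) x = (\<Sum>i\<in>I. pd j a (F i) x)"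
proof -
  have *: "((\<lambda>y. \<Sum>i\<in>I. F i y) has_derivative (\<lambda>v. \<Sum>i\<in>I. frechet_derivative (F i) (at x) v)) (at x)"
    by (rule has_derivative_sum) (rule frechet_derivative_worksI[OF assms])
  then have "(\<lambda>y. \<Sum>i\<in>I. F i y) differentiable (at x)"
    by (auto simp: differentiable_def)
  then show ?thesis
    using assms frechet_derivative_at[OF *, symmetric] by (simp add: pd_eq_frechet_derivative)
qed

lemma norm_unit_direction: "norm (axis j (oe a) :: octo ^ 2) = 1"
  by (simp add: norm_eq_1 inner_axis_axis oe_def)

text \<open>
  The mean value theorem is applied first in the direction of the index \<open>(i, a)\<close>, to the difference of
  \<open>F\<close> along two parallel segments, and then in the direction of \<open>(j, b)\<close>.
\<close>

lemma second_difference_mean_value: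
  fixes F :: "octo ^ 2 \<Rightarrow> real"
  assumes "smooth_on S F" "open S" "cball x (2 * h) \<subseteq> S" "0 < h"
  obtains y where "y \<in> cball x (2 * h)"
    "F (x + h *\<^sub>R axis i (oe a) + h *\<^sub>R axis j (oe b)) - F (x + h *\<^sub>R axis i (oe a))
      - F (x + h *\<^sub>R axis j (oe b)) + F x = h\<^sup>2 * pd j b (pd i a F) y"
proof -
  let ?u = "axis i (oe a) :: octo ^ 2" and ?v = "axis j (oe b) :: octo ^ 2"
  have near: "x + s *\<^sub>R ?u + t *\<^sub>R ?v \<in> cball x (2 * h)" if "0 \<le> s" "s \<le> h" "0 \<le> t" "t \<le> h" for s t
  proof -
    have "norm (s *\<^sub>R ?u + t *\<^sub>R ?v) \<le> norm (s *\<^sub>R ?u) + norm (t *\<^sub>R ?v)"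
      by (rule norm_triangle_ineq)
    also have "\<dots> \<le> 2 * h"
      using that by (simp add: norm_unit_direction)
    finally have "dist (x + s *\<^sub>R ?u + t *\<^sub>R ?v) x \<le> 2 * h"
      by (simp add: dist_norm add.assoc)
    then show ?thesis
      by (simp add: dist_commute)
  qed
  have line: "((\<lambda>s. G (y + s *\<^sub>R axis k (oe c))) has_real_derivative pd k c G (y + s *\<^sub>R axis k (oe c))) (at s)"
    if "smooth_on S G" "y + s *\<^sub>R axis k (oe c) \<in> S" for G y k c s
    using has_vector_derivative_along_line[of G y s k c] smooth_on_differentiable[OF that]
    by (simp add: pd_eq_frechet_derivative has_real_derivative_iff_has_vector_derivative)
  define \<phi> where "\<phi> s = F (x + h *\<^sub>R ?v + s *\<^sub>R ?u) - F (x + s *\<^sub>R ?u)" for s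
  have "(\<phi> has_real_derivative pd i a F (x + h *\<^sub>R ?v + s *\<^sub>R ?u) - pd i a F (x + s *\<^sub>R ?u)) (at s)"
    if "0 \<le> s" "s \<le> h" for s
    unfolding \<phi>_def using near[OF that, of h] near[OF that, of 0] assms(3,4)
    by (intro DERIV_diff line assms(1)) (auto simp: algebra_simps)
  from MVT2[OF assms(4) this]
  obtain s where s: "0 < s" "s < h"
    "\<phi> h - \<phi> 0 = h * (pd i a F (x + h *\<^sub>R ?v + s *\<^sub>R ?u) - pd i a F (x + s *\<^sub>R ?u))"
    by auto
  have "((\<lambda>t. pd i a F (x + s *\<^sub>R ?u + t *\<^sub>R ?v)) has_real_derivative
      pd j b (pd i a F) (x + s *\<^sub>R ?u + t *\<^sub>R ?v)) (at t)" if "0 \<le> t" "t \<le> h" for t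
    using near[OF _ _ that, of s] s assms(3)
    by (intro line smooth_on_pd assms(1,2)) auto
  from MVT2[OF assms(4) this]
  obtain t where t: "0 < t" "t < h"
    "pd i a F (x + s *\<^sub>R ?u + h *\<^sub>R ?v) - pd i a F (x + s *\<^sub>R ?u + 0 *\<^sub>R ?v)
      = h * pd j b (pd i a F) (x + s *\<^sub>R ?u + t *\<^sub>R ?v)"
    by auto
  have "\<phi> h - \<phi> 0 = h * (h * pd j b (pd i a F) (x + s *\<^sub>R ?u + t *\<^sub>R ?v))"
    unfolding s(3) using t(3) by (simp add: add_ac)
  then show thesis
    using near[of s t] s(1,2) t(1,2)
    by (intro that[of "x + s *\<^sub>R ?u + t *\<^sub>R ?v"])
      (simp_all add: \<phi>_def power2_eq_square algebra_simps)
qed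

text \<open>
  Schwarz's theorem. The second difference is symmetric in the two directions, so by the mean value
  lemma the two mixed derivatives take a common value, each at its own point near \<open>x\<close>. By continuity
  they agree at \<open>x\<close>.
\<close>

lemma pd_commute_real:
  fixes F :: "octo ^ 2 \<Rightarrow> real"
  assumes "open S" "smooth_on S F" "x \<in> S"
  shows "pd i a (pd j b F) x = pd j b (pd i a F) x"
proof (rule ccontr)
  assume neq: "pd i a (pd j b F) x \<noteq> pd j b (pd i a F) x"
  define e where "e = \<bar>pd i a (pd j b F) x - pd j b (pd i a F) x\<bar> / 2"
  have "e > 0"
    using neq by (simp add: e_def)
  have cont: "\<exists>d>0. \<forall>y. dist y x < d \<longrightarrow> \<bar>pd k c (pd l m F) y - pd k c (pd l m F) x\<bar> < e" for k c l m
  proof -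
    have "continuous (at x) (pd k c (pd l m F))"
      using smooth_on_continuous_on[OF smooth_on_pd[OF assms(1) smooth_on_pd[OF assms(1,2)]], of k c l m]
        assms(1,3) by (simp add: continuous_on_eq_continuous_at)
    then show ?thesis
      using \<open>e > 0\<close> by (auto simp: continuous_at_eps_delta dist_real_def)
  qed
  obtain d1 where d1: "d1 > 0" "\<And>y. dist y x < d1 \<Longrightarrow> \<bar>pd i a (pd j b F) y - pd i a (pd j b F) x\<bar> < e"
    using cont by blast
  obtain d2 where d2: "d2 > 0" "\<And>y. dist y x < d2 \<Longrightarrow> \<bar>pd j b (pd i a F) y - pd j b (pd i a F) x\<bar> < e"
    using cont by blast
  obtain r where r: "r > 0" "ball x r \<subseteq> S"
    using assms(1,3) open_contains_ball by blast
  \<comment> \<open>Small enough for \<open>cball x (2 * h)\<close> to lie in \<open>S\<close> and in both continuity neighbourhoods.\<close>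
  define h where "h = min r (min d1 d2) / 3"
  have h: "h > 0" "2 * h < r" "2 * h < d1" "2 * h < d2"
    using r(1) d1(1) d2(1) by (auto simp: h_def)
  have sub: "cball x (2 * h) \<subseteq> S"
    using r(2) h by (auto intro: subset_trans[OF _ r(2)])
  obtain y where y: "y \<in> cball x (2 * h)"
    "F (x + h *\<^sub>R axis i (oe a) + h *\<^sub>R axis j (oe b)) - F (x + h *\<^sub>R axis i (oe a))
      - F (x + h *\<^sub>R axis j (oe b)) + F x = h\<^sup>2 * pd j b (pd i a F) y"
    by (rule second_difference_mean_value[OF assms(2,1) sub h(1)])
  obtain z where z: "z \<in> cball x (2 * h)"
    "F (x + h *\<^sub>R axis j (oe b) + h *\<^sub>R axis i (oe a)) - F (x + h *\<^sub>R axis j (oe b))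
      - F (x + h *\<^sub>R axis i (oe a)) + F x = h\<^sup>2 * pd i a (pd j b F) z"
    by (rule second_difference_mean_value[OF assms(2,1) sub h(1)])
  have "h\<^sup>2 * pd i a (pd j b F) z = h\<^sup>2 * pd j b (pd i a F) y"
    unfolding y(2)[symmetric] z(2)[symmetric] by (simp add: add_ac)
  then have "pd i a (pd j b F) z = pd j b (pd i a F) y"
    using h(1) by simp
  moreover have "\<bar>pd i a (pd j b F) z - pd i a (pd j b F) x\<bar> < e"
    using z(1) h by (intro d1(2)) (simp add: dist_commute)
  moreover have "\<bar>pd j b (pd i a F) y - pd j b (pd i a F) x\<bar> < e"
    using y(1) h by (intro d2(2)) (simp add: dist_commute)
  ultimately show False
    by (simp add: e_def field_simps abs_if split: if_splits)
qed

lemma pd_commute: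
  fixes F :: "octo ^ 2 \<Rightarrow> 'b::euclidean_space"
  assumes "open S" "smooth_on S F" "x \<in> S"
  shows "pd i a (pd j b F) x = pd j b (pd i a F) x"
proof (rule euclidean_eqI)
  fix c :: 'b
  note L = bounded_linear_inner_left[of c]
  have comp: "pd k l (pd m n F) x \<bullet> c = pd k l (pd m n (\<lambda>y. F y \<bullet> c)) x" for k l m n
  proof -
    note smooth = smooth_on_pd[OF assms(1,2), of m n]
    have "pd k l (pd m n F) x \<bullet> c = pd k l (\<lambda>y. pd m n F y \<bullet> c) x"
      by (rule pd_bounded_linear[OF L smooth_on_differentiable[OF smooth assms(3)], symmetric])
    also have "\<dots> = pd k l (pd m n (\<lambda>y. F y \<bullet> c)) x"
      by (rule pd_cong_on[OF assms(1,3) _ smooth_on_bounded_linear[OF assms(1) L smooth]])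
        (rule pd_bounded_linear[OF L smooth_on_differentiable[OF assms(2)], symmetric])
    finally show ?thesis .
  qed
  show "pd i a (pd j b F) x \<bullet> c = pd j b (pd i a F) x \<bullet> c"
    unfolding comp
    by (rule pd_commute_real[OF assms(1) smooth_on_bounded_linear[OF assms(1) L assms(2)] assms(3)])
qed

section \<open>Iterated derivatives and polynomials in the covector\<close>

text \<open>
  A word in the coordinate indices \<open>(j, a)\<close> is used instead of a multi-index, because composing
  operators then amounts to prefixing letters. The price is that words with the same letters have to
  be identified afterwards.
\<close>

primrec pds :: "(2 \<times> 8) list \<Rightarrow> (octo ^ 2 \<Rightarrow> 'b::real_normed_vector) \<Rightarrow> octo ^ 2 \<Rightarrow> 'b" where
  "pds [] F = F"
| "pds (p # \<alpha>) F = pd (fst p) (snd p) (pds \<alpha> F)"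

definition monomial :: "octo ^ 2 \<Rightarrow> (2 \<times> 8) list \<Rightarrow> real" where
  "monomial \<xi> \<alpha> = prod_list (map (\<lambda>p. \<xi> $ fst p $ snd p) \<alpha>)"

abbreviation words :: "nat \<Rightarrow> 'i list set" where
  "words k \<equiv> {\<alpha>. length \<alpha> = k}"

lemma finite_words: "finite (words k :: 'i::finite list set)"
  using finite_lists_length_eq[of "UNIV :: 'i set" k] by simp

lemma sum_words_Suc:
  fixes g :: "'i::finite list \<Rightarrow> 'b::comm_monoid_add"
  shows "(\<Sum>\<alpha>\<in>words (Suc k). g \<alpha>) = (\<Sum>p\<in>UNIV. \<Sum>\<alpha>\<in>words k. g (p # \<alpha>))"
proof -
  have "(\<Sum>\<alpha>\<in>words (Suc k). g \<alpha>) = (\<Sum>(p, \<alpha>)\<in>UNIV \<times> words k. g (p # \<alpha>))"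
    by (rule sum.reindex_bij_witness[where i = "\<lambda>(p, \<alpha>). p # \<alpha>" and j = "\<lambda>\<alpha>. (hd \<alpha>, tl \<alpha>)"])
      (auto simp: length_Suc_conv)
  then show ?thesis
    by (simp add: sum.cartesian_product)
qed

lemma smooth_on_pds: "open S \<Longrightarrow> smooth_on S F \<Longrightarrow> smooth_on S (pds \<alpha> F)"
  by (induction \<alpha>) (simp_all add: smooth_on_pd)

lemma pds_cong_on:
  assumes "open S" "smooth_on S F" "\<And>y. y \<in> S \<Longrightarrow> F y = G y" "x \<in> S"
  shows "pds \<alpha> F x = pds \<alpha> G x"
  using assms(4)
proof (induction \<alpha> arbitrary: x)
  case (Cons p \<alpha>)
  then show ?case
    using pd_cong_on[OF assms(1) Cons.prems _ smooth_on_pds[OF assms(1,2)], of \<alpha>] by simp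
qed (simp add: assms(3))

lemma pds_move_to_front:
  fixes F :: "octo ^ 2 \<Rightarrow> 'b::euclidean_space"
  assumes "open S" "smooth_on S F" "x \<in> S"
  shows "pds (\<alpha> @ p # \<beta>) F x = pds (p # \<alpha> @ \<beta>) F x"
  using assms(3)
proof (induction \<alpha> arbitrary: x)
  case (Cons q \<alpha>)
  have "pds ((q # \<alpha>) @ p # \<beta>) F x = pd (fst q) (snd q) (pds (p # \<alpha> @ \<beta>) F) x"
    using pd_cong_on[OF assms(1) Cons.prems Cons.IH smooth_on_pds[OF assms(1,2)]] by simp
  also have "\<dots> = pds (p # (q # \<alpha>) @ \<beta>) F x"
    using pd_commute[OF assms(1) smooth_on_pds[OF assms(1,2)] Cons.prems] by simp
  finally show ?case .
qed simp

lemma pds_mset_cong: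
  fixes F :: "octo ^ 2 \<Rightarrow> 'b::euclidean_space"
  assumes "open S" "smooth_on S F" "x \<in> S" "mset \<alpha> = mset \<beta>"
  shows "pds \<alpha> F x = pds \<beta> F x"
  using assms(3,4)
proof (induction \<alpha> arbitrary: \<beta> x)
  case (Cons p \<alpha>)
  have "p \<in> set \<beta>"
    using Cons.prems(2) by (metis list.set_intros(1) set_mset_mset)
  then obtain \<beta>1 \<beta>2 where \<beta>: "\<beta> = \<beta>1 @ p # \<beta>2"
    by (auto simp: in_set_conv_decomp)
  then have "mset \<alpha> = mset (\<beta>1 @ \<beta>2)"
    using Cons.prems(2) by simp
  then have "pds (p # \<alpha>) F x = pds (p # \<beta>1 @ \<beta>2) F x"
    using pd_cong_on[OF assms(1) Cons.prems(1) Cons.IH smooth_on_pds[OF assms(1,2)]] by simp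
  then show ?case
    unfolding \<beta> using pds_move_to_front[OF assms(1,2) Cons.prems(1)] by metis
qed simp

text \<open>
  Uniqueness of the digits in base \<open>b\<close>, for a fixed number of digits.
\<close>

lemma base_digits_unique:
  fixes c d :: "nat \<Rightarrow> nat"
  assumes "\<And>i. i < n \<Longrightarrow> c i < b" "\<And>i. i < n \<Longrightarrow> d i < b"
    and "(\<Sum>i<n. c i * b ^ i) = (\<Sum>i<n. d i * b ^ i)" and "i < n"
  shows "c i = d i"
  using assms
proof (induction n arbitrary: c d i)
  case (Suc n)
  have shift: "(\<Sum>i<Suc n. f i * b ^ i) = f 0 + b * (\<Sum>i<n. f (Suc i) * b ^ i)" for f :: "nat \<Rightarrow> nat"
    by (simp add: sum.lessThan_Suc_shift sum_distrib_left mult_ac del: sum.lessThan_Suc)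
  have eq: "c 0 + b * (\<Sum>i<n. c (Suc i) * b ^ i) = d 0 + b * (\<Sum>i<n. d (Suc i) * b ^ i)"
    using Suc.prems(3) unfolding shift .
  have b: "c 0 < b" "d 0 < b"
    using Suc.prems(1,2) by auto
  have "c 0 = d 0"
    using arg_cong[OF eq, of "\<lambda>m. m mod b"] b by simp
  moreover have "(\<Sum>i<n. c (Suc i) * b ^ i) = (\<Sum>i<n. d (Suc i) * b ^ i)"
    using eq b calculation by simp
  then have "c (Suc j) = d (Suc j)" if "j < n" for j
    using Suc.IH[of "\<lambda>i. c (Suc i)" "\<lambda>i. d (Suc i)" j] Suc.prems(1,2) that by simp
  ultimately show ?case
    using Suc.prems(4) by (cases i) auto
qed simp

text \<open>
  Kronecker substitution: give the letters the weights \<open>1, k + 1, (k + 1)\<^sup>2, \<dots>\<close>. A letter occurs at most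
  \<open>k\<close> times in a word of length \<open>k\<close>, so its multiplicities are the digits of the total weight in base
  \<open>k + 1\<close>.
\<close>

lemma separating_weight_exists:
  "\<exists>w :: 'i::finite \<Rightarrow> nat. \<forall>\<alpha>\<in>words k. \<forall>\<beta>\<in>words k.
     sum_list (map w \<alpha>) = sum_list (map w \<beta>) \<longrightarrow> mset \<alpha> = mset \<beta>"
proof -
  define n where "n = CARD('i)"
  obtain h :: "'i \<Rightarrow> nat" where "bij_betw h UNIV {0..<n}"
    unfolding n_def using ex_bij_betw_finite_nat[OF finite_class.finite_UNIV] by blast
  then have h: "bij_betw h UNIV {..<n}"
    by (simp add: atLeast0LessThan)
  define g where "g = inv_into UNIV h"
  have g: "g (h p) = p" for p
    using h by (simp add: g_def bij_betw_def)
  define w where "w p = Suc k ^ h p" for p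
  have expand: "sum_list (map w \<alpha>) = (\<Sum>i<n. count_list \<alpha> (g i) * Suc k ^ i)" for \<alpha>
  proof -
    have "sum_list (map w \<alpha>) = (\<Sum>p\<in>UNIV. count_list \<alpha> p * w p)"
      by (rule sum_list_map_eq_sum_count2) auto
    also have "\<dots> = (\<Sum>p\<in>UNIV. count_list \<alpha> (g (h p)) * Suc k ^ h p)"
      by (simp add: w_def g)
    also have "\<dots> = (\<Sum>i<n. count_list \<alpha> (g i) * Suc k ^ i)"
      by (rule sum.reindex_bij_betw[OF h])
    finally show ?thesis .
  qed
  have "mset \<alpha> = mset \<beta>"
    if "\<alpha> \<in> words k" "\<beta> \<in> words k" "sum_list (map w \<alpha>) = sum_list (map w \<beta>)" for \<alpha> \<beta>
  proof (rule multiset_eqI)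
    fix p
    have bound: "count_list \<gamma> q < Suc k" if "\<gamma> \<in> words k" for \<gamma> and q :: 'i
      using count_le_length[of \<gamma> q] that by simp
    have "h p < n"
      using h by (auto simp: bij_betw_def)
    have "count_list \<alpha> (g (h p)) = count_list \<beta> (g (h p))"
      by (rule base_digits_unique[where n = n and b = "Suc k"
            and c = "\<lambda>i. count_list \<alpha> (g i)" and d = "\<lambda>i. count_list \<beta> (g i)"])
        (use bound[OF that(1)] bound[OF that(2)] that(3) \<open>h p < n\<close> in \<open>simp_all only: expand\<close>)
    then show "count (mset \<alpha>) p = count (mset \<beta>) p"
      by (simp add: g count_mset)
  qed
  then show ?thesis
    by blast
qed

text \<open>
  If the polynomial with coefficients \<open>A\<close> vanishes, then for each multiset of letters the coefficients
  of the words with these letters add up to zero, and a family \<open>s\<close> that depends only on the multiset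
  cannot detect the individual coefficients. To separate the multisets, a single real variable \<open>t\<close>
  is substituted, raised to the separating weight of each letter; this reduces the claim to
  polynomials in one variable.
\<close>

lemma symmetric_contraction_eq_0:
  fixes A :: "(2 \<times> 8) list \<Rightarrow> 'b \<Rightarrow> 'c::euclidean_space"
  assumes zero: "\<And>\<xi> w. (\<Sum>\<alpha>\<in>words k. monomial \<xi> \<alpha> *\<^sub>R A \<alpha> w) = 0"
    and sym: "\<And>\<alpha> \<beta>. mset \<alpha> = mset \<beta> \<Longrightarrow> s \<alpha> = s \<beta>"
  shows "(\<Sum>\<alpha>\<in>words k. A \<alpha> (s \<alpha>)) = 0"
proof -
  obtain w :: "2 \<times> 8 \<Rightarrow> nat" where w: "\<And>\<alpha> \<beta>. \<alpha> \<in> words k \<Longrightarrow> \<beta> \<in> words k \<Longrightarrow>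
      sum_list (map w \<alpha>) = sum_list (map w \<beta>) \<Longrightarrow> mset \<alpha> = mset \<beta>"
    using separating_weight_exists[of k] by blast
  define e where "e \<alpha> = sum_list (map w \<alpha>)" for \<alpha>
  define M where "M = Max (e ` words k)"
  have e_le: "e ` words k \<subseteq> {..M}"
    by (auto simp: M_def finite_words)
  have group: "(\<Sum>\<alpha>\<in>words k. f \<alpha>) = (\<Sum>m\<le>M. \<Sum>\<alpha>\<in>{\<alpha>\<in>words k. e \<alpha> = m}. f \<alpha>)"
    for f :: "(2 \<times> 8) list \<Rightarrow> 'd::comm_monoid_add"
    by (rule sum.group[OF finite_words finite_atMost e_le, symmetric])
  \<comment> \<open>Words of equal total weight \<open>m\<close> are exactly those that share the monomial \<open>t ^ m\<close>.\<close>
  have coeff: "(\<Sum>\<alpha>\<in>{\<alpha>\<in>words k. e \<alpha> = m}. A \<alpha> v) = 0" if "m \<le> M" for m v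
  proof (rule euclidean_eqI)
    fix c :: 'c
    define p where "p m = (\<Sum>\<alpha>\<in>{\<alpha>\<in>words k. e \<alpha> = m}. A \<alpha> v \<bullet> c)" for m
    have "(\<Sum>m\<le>M. p m * t ^ m) = 0" for t :: real
    proof -
      define \<xi> :: "octo ^ 2" where "\<xi> = (\<chi> j a. t ^ w (j, a))"
      have mono: "monomial \<xi> \<alpha> = t ^ e \<alpha>" for \<alpha>
        by (induction \<alpha>) (simp_all add: monomial_def \<xi>_def e_def power_add)
      have "(\<Sum>m\<le>M. p m * t ^ m)
          = (\<Sum>m\<le>M. \<Sum>\<alpha>\<in>{\<alpha>\<in>words k. e \<alpha> = m}. t ^ e \<alpha> * (A \<alpha> v \<bullet> c))"
        by (simp add: p_def sum_distrib_left mult.commute)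
      also have "\<dots> = (\<Sum>\<alpha>\<in>words k. t ^ e \<alpha> * (A \<alpha> v \<bullet> c))"
        by (rule group[symmetric])
      also have "\<dots> = (\<Sum>\<alpha>\<in>words k. monomial \<xi> \<alpha> *\<^sub>R A \<alpha> v) \<bullet> c"
        by (simp add: inner_sum_left mono)
      finally show ?thesis
        by (simp add: zero)
    qed
    then have "p m = 0"
      using polyfun_eq_0[of p M] that by blast
    then show "(\<Sum>\<alpha>\<in>{\<alpha>\<in>words k. e \<alpha> = m}. A \<alpha> v) \<bullet> c = 0 \<bullet> c"
      by (simp add: p_def inner_sum_left)
  qed
  have "(\<Sum>\<alpha>\<in>{\<alpha>\<in>words k. e \<alpha> = m}. A \<alpha> (s \<alpha>)) = 0" if "m \<le> M" for m
  proof (cases "{\<alpha>\<in>words k. e \<alpha> = m} = {}")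
    case False
    then obtain \<beta> where \<beta>: "\<beta> \<in> words k" "e \<beta> = m"
      by blast
    have "(\<Sum>\<alpha>\<in>{\<alpha>\<in>words k. e \<alpha> = m}. A \<alpha> (s \<alpha>)) = (\<Sum>\<alpha>\<in>{\<alpha>\<in>words k. e \<alpha> = m}. A \<alpha> (s \<beta>))"
    proof (rule sum.cong)
      fix \<alpha> assume "\<alpha> \<in> {\<alpha> \<in> words k. e \<alpha> = m}"
      then show "A \<alpha> (s \<alpha>) = A \<alpha> (s \<beta>)"
        using sym[OF w[of \<alpha> \<beta>]] \<beta> by (simp add: e_def)
    qed simp
    then show ?thesis
      using coeff[OF that] by simp
  qed (simp only: sum.empty)
  then show ?thesis
    by (simp add: group)
qed

section \<open>Constant-coefficient operators and their symbols\<close>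

text \<open>
  On functions that are smooth on \<open>\<Omega>\<close>, the operator \<open>P\<close> is homogeneous of order \<open>k\<close> with constant
  coefficients \<open>A\<close>, and \<open>\<sigma>\<close> is the polynomial with the same coefficients. The coefficients are hidden
  because they are not unique: only their symmetric parts matter.
\<close>

definition has_symbol ::
  "(octo ^ 2) set \<Rightarrow> nat \<Rightarrow> ((octo ^ 2 \<Rightarrow> 'b::euclidean_space) \<Rightarrow> octo ^ 2 \<Rightarrow> 'c::euclidean_space)
    \<Rightarrow> (octo ^ 2 \<Rightarrow> 'b \<Rightarrow> 'c) \<Rightarrow> bool" where
  "has_symbol \<Omega> k P \<sigma> \<longleftrightarrow> (\<exists>A. (\<forall>\<alpha>. bounded_linear (A \<alpha>))
    \<and> (\<forall>F x. smooth_on \<Omega> F \<longrightarrow> x \<in> \<Omega> \<longrightarrow> P F x = (\<Sum>\<alpha>\<in>words k. A \<alpha> (pds \<alpha> F x)))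
    \<and> (\<forall>\<xi> w. \<sigma> \<xi> w = (\<Sum>\<alpha>\<in>words k. monomial \<xi> \<alpha> *\<^sub>R A \<alpha> w)))"

context
  fixes \<Omega> :: "(octo ^ 2) set"
  assumes open_\<Omega>: "open \<Omega>"
begin

lemma has_symbol_smooth_on:
  assumes "has_symbol \<Omega> k P \<sigma>" "smooth_on \<Omega> F"
  shows "smooth_on \<Omega> (P F)"
proof -
  obtain A where A: "\<And>\<alpha>. bounded_linear (A \<alpha>)"
    "\<And>x. x \<in> \<Omega> \<Longrightarrow> P F x = (\<Sum>\<alpha>\<in>words k. A \<alpha> (pds \<alpha> F x))"
    using assms unfolding has_symbol_def by blast
  show ?thesis
  proof (rule smooth_on_cong[OF open_\<Omega>])
    show "smooth_on \<Omega> (\<lambda>x. \<Sum>\<alpha>\<in>words k. A \<alpha> (pds \<alpha> F x))"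
      by (rule smooth_on_sum[OF open_\<Omega> smooth_on_bounded_linear[OF open_\<Omega> A(1)
            smooth_on_pds[OF open_\<Omega> assms(2)]]])
  qed (simp add: A(2))
qed

lemma has_symbol_cong_on:
  assumes "has_symbol \<Omega> k P \<sigma>" "smooth_on \<Omega> F" "\<And>y. y \<in> \<Omega> \<Longrightarrow> F y = G y" "x \<in> \<Omega>"
  shows "P F x = P G x"
proof -
  have "smooth_on \<Omega> G"
    using smooth_on_cong[OF open_\<Omega> assms(3,2)] .
  then show ?thesis
    using assms(1,2,4) pds_cong_on[OF open_\<Omega> assms(2,3,4)] unfolding has_symbol_def by auto
qed

text \<open>
  The central principle. Derivatives of a smooth function are symmetric in the letters of the word,
  so the expansion of \<open>P\<close> is a symmetric contraction.
\<close>

lemma has_symbol_0_imp_eq_0: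
  assumes "has_symbol \<Omega> k P \<sigma>" "\<And>\<xi> w. \<sigma> \<xi> w = 0" "smooth_on \<Omega> F" "x \<in> \<Omega>"
  shows "P F x = 0"
proof -
  obtain A where A: "P F x = (\<Sum>\<alpha>\<in>words k. A \<alpha> (pds \<alpha> F x))"
    "\<And>\<xi> w. \<sigma> \<xi> w = (\<Sum>\<alpha>\<in>words k. monomial \<xi> \<alpha> *\<^sub>R A \<alpha> w)"
    using assms(1,3,4) unfolding has_symbol_def by blast
  show ?thesis
    unfolding A(1)
  proof (rule symmetric_contraction_eq_0[where A = A and s = "\<lambda>\<alpha>. pds \<alpha> F x"])
    show "(\<Sum>\<alpha>\<in>words k. monomial \<xi> \<alpha> *\<^sub>R A \<alpha> w) = 0" for \<xi> w
      unfolding A(2)[symmetric] by (rule assms(2))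
    show "pds \<alpha> F x = pds \<beta> F x" if "mset \<alpha> = mset \<beta>" for \<alpha> \<beta>
      by (rule pds_mset_cong[OF open_\<Omega> assms(3,4) that])
  qed
qed

lemma has_symbol_id: "has_symbol \<Omega> 0 (\<lambda>F x. F x) (\<lambda>\<xi> w. w)"
  unfolding has_symbol_def
  by (rule exI[of _ "\<lambda>\<alpha> w. w"]) (simp add: monomial_def bounded_linear_ident)

text \<open>
  This and the following rules generate all operators of the complex from the identity: linear maps
  on values, sums, and partial derivatives. Each rule applies an operation after an arbitrary \<open>P\<close>, so
  that compositions need no rule of their own.
\<close>

lemma has_symbol_linear:
  assumes "has_symbol \<Omega> k P \<sigma>" "bounded_linear L"
  shows "has_symbol \<Omega> k (\<lambda>F x. L (P F x)) (\<lambda>\<xi> w. L (\<sigma> \<xi> w))"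
proof -
  interpret L: bounded_linear L by fact
  obtain A where "\<And>\<alpha>. bounded_linear (A \<alpha>)"
    "\<And>F x. smooth_on \<Omega> F \<Longrightarrow> x \<in> \<Omega> \<Longrightarrow> P F x = (\<Sum>\<alpha>\<in>words k. A \<alpha> (pds \<alpha> F x))"
    "\<And>\<xi> w. \<sigma> \<xi> w = (\<Sum>\<alpha>\<in>words k. monomial \<xi> \<alpha> *\<^sub>R A \<alpha> w)"
    using assms(1) unfolding has_symbol_def by blast
  then show ?thesis
    unfolding has_symbol_def
    by (intro exI[of _ "\<lambda>\<alpha> w. L (A \<alpha> w)"])
      (simp add: bounded_linear_compose[OF assms(2)] L.sum L.scaleR)
qed

lemma has_symbol_sum:
  assumes "\<And>i. i \<in> I \<Longrightarrow> has_symbol \<Omega> k (P i) (\<sigma> i)"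
  shows "has_symbol \<Omega> k (\<lambda>F x. \<Sum>i\<in>I. P i F x) (\<lambda>\<xi> w. \<Sum>i\<in>I. \<sigma> i \<xi> w)"
proof -
  have "\<forall>i\<in>I. \<exists>A. (\<forall>\<alpha>. bounded_linear (A \<alpha>))
      \<and> (\<forall>F x. smooth_on \<Omega> F \<longrightarrow> x \<in> \<Omega> \<longrightarrow> P i F x = (\<Sum>\<alpha>\<in>words k. A \<alpha> (pds \<alpha> F x)))
      \<and> (\<forall>\<xi> w. \<sigma> i \<xi> w = (\<Sum>\<alpha>\<in>words k. monomial \<xi> \<alpha> *\<^sub>R A \<alpha> w))"
    using assms unfolding has_symbol_def ..
  from bchoice[OF this] obtain A where "\<forall>i\<in>I. (\<forall>\<alpha>. bounded_linear (A i \<alpha>))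
      \<and> (\<forall>F x. smooth_on \<Omega> F \<longrightarrow> x \<in> \<Omega> \<longrightarrow> P i F x = (\<Sum>\<alpha>\<in>words k. A i \<alpha> (pds \<alpha> F x)))
      \<and> (\<forall>\<xi> w. \<sigma> i \<xi> w = (\<Sum>\<alpha>\<in>words k. monomial \<xi> \<alpha> *\<^sub>R A i \<alpha> w))"
    ..
  then have A: "\<And>i \<alpha>. i \<in> I \<Longrightarrow> bounded_linear (A i \<alpha>)"
    "\<And>i F x. i \<in> I \<Longrightarrow> smooth_on \<Omega> F \<Longrightarrow> x \<in> \<Omega> \<Longrightarrow> P i F x = (\<Sum>\<alpha>\<in>words k. A i \<alpha> (pds \<alpha> F x))"
    "\<And>i \<xi> w. i \<in> I \<Longrightarrow> \<sigma> i \<xi> w = (\<Sum>\<alpha>\<in>words k. monomial \<xi> \<alpha> *\<^sub>R A i \<alpha> w)"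
    by blast+
  show ?thesis
    unfolding has_symbol_def
  proof (intro exI[of _ "\<lambda>\<alpha> w. \<Sum>i\<in>I. A i \<alpha> w"] conjI allI impI)
    show "bounded_linear (\<lambda>w. \<Sum>i\<in>I. A i \<alpha> w)" for \<alpha>
      using A(1) by (rule bounded_linear_sum)
    show "(\<Sum>i\<in>I. P i F x) = (\<Sum>\<alpha>\<in>words k. \<Sum>i\<in>I. A i \<alpha> (pds \<alpha> F x))"
      if "smooth_on \<Omega> F" "x \<in> \<Omega>" for F x
      by (subst sum.swap) (simp add: A(2) that)
    show "(\<Sum>i\<in>I. \<sigma> i \<xi> w) = (\<Sum>\<alpha>\<in>words k. monomial \<xi> \<alpha> *\<^sub>R (\<Sum>i\<in>I. A i \<alpha> w))" for \<xi> w
      unfolding scaleR_sum_right by (subst sum.swap) (simp add: A(3))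
  qed
qed

lemma has_symbol_add:
  assumes "has_symbol \<Omega> k P \<sigma>" "has_symbol \<Omega> k Q \<tau>"
  shows "has_symbol \<Omega> k (\<lambda>F x. P F x + Q F x) (\<lambda>\<xi> w. \<sigma> \<xi> w + \<tau> \<xi> w)"
  using has_symbol_sum[of "UNIV :: bool set" k "\<lambda>b. if b then P else Q" "\<lambda>b. if b then \<sigma> else \<tau>"] assms
  by (simp add: UNIV_bool add.commute)

lemma has_symbol_diff:
  assumes "has_symbol \<Omega> k P \<sigma>" "has_symbol \<Omega> k Q \<tau>"
  shows "has_symbol \<Omega> k (\<lambda>F x. P F x - Q F x) (\<lambda>\<xi> w. \<sigma> \<xi> w - \<tau> \<xi> w)"
  using has_symbol_add[OF assms(1) has_symbol_linear[OF assms(2) bounded_linear_minus[OF bounded_linear_ident]]]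
  by simp

lemma has_symbol_pd:
  assumes "has_symbol \<Omega> k P \<sigma>"
  shows "has_symbol \<Omega> (Suc k) (\<lambda>F x. pd j a (P F) x) (\<lambda>\<xi> w. \<xi> $ j $ a *\<^sub>R \<sigma> \<xi> w)"
proof -
  obtain A where A: "\<And>\<alpha>. bounded_linear (A \<alpha>)"
    "\<And>F x. smooth_on \<Omega> F \<Longrightarrow> x \<in> \<Omega> \<Longrightarrow> P F x = (\<Sum>\<alpha>\<in>words k. A \<alpha> (pds \<alpha> F x))"
    "\<And>\<xi> w. \<sigma> \<xi> w = (\<Sum>\<alpha>\<in>words k. monomial \<xi> \<alpha> *\<^sub>R A \<alpha> w)"
    using assms unfolding has_symbol_def by blast
  \<comment> \<open>The coefficients of the differentiated operator live on the words that start with \<open>(j, a)\<close>.\<close>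
  define B where "B \<alpha> w = (if hd \<alpha> = (j, a) then A (tl \<alpha>) w else 0)" for \<alpha> w
  have collapse: "(\<Sum>\<alpha>\<in>words (Suc k). g \<alpha> *\<^sub>R B \<alpha> (s \<alpha>))
      = (\<Sum>\<alpha>\<in>words k. g ((j, a) # \<alpha>) *\<^sub>R A \<alpha> (s ((j, a) # \<alpha>)))" for g :: "_ \<Rightarrow> real" and s
  proof -
    have "(\<Sum>\<alpha>\<in>words k. g (p # \<alpha>) *\<^sub>R B (p # \<alpha>) (s (p # \<alpha>)))
        = (if (j, a) = p then \<Sum>\<alpha>\<in>words k. g (p # \<alpha>) *\<^sub>R A \<alpha> (s (p # \<alpha>)) else 0)" for p
      by (auto simp: B_def)
    then show ?thesis
      by (simp add: sum_words_Suc del: split_paired_All)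
  qed
  show ?thesis
    unfolding has_symbol_def
  proof (intro exI[of _ B] conjI allI impI)
    show "bounded_linear (B \<alpha>)" for \<alpha>
      by (cases "hd \<alpha> = (j, a)") (simp_all add: B_def[abs_def] A(1))
    show "\<xi> $ j $ a *\<^sub>R \<sigma> \<xi> w = (\<Sum>\<alpha>\<in>words (Suc k). monomial \<xi> \<alpha> *\<^sub>R B \<alpha> w)" for \<xi> w
      using collapse[of "monomial \<xi>" "\<lambda>_. w"] by (simp add: A(3) scaleR_sum_right monomial_def)
    fix F :: "octo ^ 2 \<Rightarrow> 'a" and x assume F: "smooth_on \<Omega> F" and x: "x \<in> \<Omega>"
    note smooth = smooth_on_pds[OF open_\<Omega> F]
    note diff = smooth_on_differentiable[OF smooth_on_bounded_linear[OF open_\<Omega> A(1) smooth] x]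
    have "pd j a (P F) x = pd j a (\<lambda>y. \<Sum>\<alpha>\<in>words k. A \<alpha> (pds \<alpha> F y)) x"
      by (rule pd_cong_on[OF open_\<Omega> x A(2)[OF F] has_symbol_smooth_on[OF assms F]])
    also have "\<dots> = (\<Sum>\<alpha>\<in>words k. pd j a (\<lambda>y. A \<alpha> (pds \<alpha> F y)) x)"
      by (rule pd_sum) (rule diff)
    also have "\<dots> = (\<Sum>\<alpha>\<in>words k. A \<alpha> (pds ((j, a) # \<alpha>) F x))"
      using pd_bounded_linear[OF A(1) smooth_on_differentiable[OF smooth x]] by simp
    also have "\<dots> = (\<Sum>\<alpha>\<in>words (Suc k). B \<alpha> (pds \<alpha> F x))"
      using collapse[of "\<lambda>_. 1" "\<lambda>\<alpha>. pds \<alpha> F x"] by simp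
    finally show "pd j a (P F) x = (\<Sum>\<alpha>\<in>words (Suc k). B \<alpha> (pds \<alpha> F x))" .
  qed
qed


section \<open>The operators of the complex on an open set\<close>

lemma has_symbol_vec_nth:
  "has_symbol \<Omega> k P \<sigma> \<Longrightarrow> has_symbol \<Omega> k (\<lambda>F x. P F x $ i) (\<lambda>\<xi> w. \<sigma> \<xi> w $ i)"
  by (rule has_symbol_linear[OF _ bounded_linear_vec_nth])

text \<open>
  A vector with two entries is the sum of two linear embeddings.
\<close>

lemma has_symbol_vector:
  assumes "has_symbol \<Omega> k P \<sigma>" "has_symbol \<Omega> k Q \<tau>"
  shows "has_symbol \<Omega> k (\<lambda>F x. vector [P F x, Q F x] :: 'c::euclidean_space ^ 2)
    (\<lambda>\<xi> w. vector [\<sigma> \<xi> w, \<tau> \<xi> w])"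
proof -
  have join: "vector [y, 0] + vector [0, z] = (vector [y, z] :: 'c ^ 2)" for y z
    by (simp add: vec_eq_iff forall_2)
  have "linear (\<lambda>y. vector [y, 0] :: 'c ^ 2)" "linear (\<lambda>z. vector [0, z] :: 'c ^ 2)"
    by (auto intro!: linearI simp: vec_eq_iff forall_2)
  then have L: "bounded_linear (\<lambda>y. vector [y, 0] :: 'c ^ 2)" "bounded_linear (\<lambda>z. vector [0, z] :: 'c ^ 2)"
    by (simp_all add: linear_conv_bounded_linear)
  show ?thesis
    using has_symbol_add[OF has_symbol_linear[OF assms(1) L(1)] has_symbol_linear[OF assms(2) L(2)]]
    unfolding join .
qed

lemma has_symbol_lbar:
  assumes "has_symbol \<Omega> k P \<sigma>"
  shows "has_symbol \<Omega> (Suc k) (\<lambda>F x. lbar j (P F) x) (\<lambda>\<xi> w. \<xi> $ j \<odot> \<sigma> \<xi> w)"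
proof -
  have "has_symbol \<Omega> (Suc k) (\<lambda>F x. \<Sum>a\<in>UNIV. oe a \<odot> pd j a (P F) x)
      (\<lambda>\<xi> w. \<Sum>a\<in>UNIV. oe a \<odot> (\<xi> $ j $ a *\<^sub>R \<sigma> \<xi> w))"
    by (intro has_symbol_sum has_symbol_linear[OF _ omul.bounded_linear_right] has_symbol_pd assms)
  then show ?thesis
    by (simp add: lbar_def sum_oe_omul)
qed

lemma has_symbol_ldel:
  assumes "has_symbol \<Omega> k P \<sigma>"
  shows "has_symbol \<Omega> (Suc k) (\<lambda>F x. ldel j (P F) x) (\<lambda>\<xi> w. ocnj (\<xi> $ j) \<odot> \<sigma> \<xi> w)"
proof -
  have "has_symbol \<Omega> (Suc k) (\<lambda>F x. \<Sum>a\<in>UNIV. ocnj (oe a) \<odot> pd j a (P F) x)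
      (\<lambda>\<xi> w. \<Sum>a\<in>UNIV. ocnj (oe a) \<odot> (\<xi> $ j $ a *\<^sub>R \<sigma> \<xi> w))"
    by (intro has_symbol_sum has_symbol_linear[OF _ omul.bounded_linear_right] has_symbol_pd assms)
  then show ?thesis
    by (simp add: ldel_def sum_oe_omul)
qed

lemma has_symbol_rbar:
  assumes "has_symbol \<Omega> k P \<sigma>"
  shows "has_symbol \<Omega> (Suc k) (\<lambda>F x. rbar j (P F) x) (\<lambda>\<xi> w. \<sigma> \<xi> w \<odot> \<xi> $ j)"
proof -
  have "has_symbol \<Omega> (Suc k) (\<lambda>F x. \<Sum>a\<in>UNIV. pd j a (P F) x \<odot> oe a)
      (\<lambda>\<xi> w. \<Sum>a\<in>UNIV. (\<xi> $ j $ a *\<^sub>R \<sigma> \<xi> w) \<odot> oe a)"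
    by (intro has_symbol_sum has_symbol_linear[OF _ omul.bounded_linear_left] has_symbol_pd assms)
  then show ?thesis
    by (simp add: rbar_def sum_oe_omul)
qed

lemma has_symbol_rdel:
  assumes "has_symbol \<Omega> k P \<sigma>"
  shows "has_symbol \<Omega> (Suc k) (\<lambda>F x. rdel j (P F) x) (\<lambda>\<xi> w. \<sigma> \<xi> w \<odot> ocnj (\<xi> $ j))"
proof -
  have "has_symbol \<Omega> (Suc k) (\<lambda>F x. \<Sum>a\<in>UNIV. pd j a (P F) x \<odot> ocnj (oe a))
      (\<lambda>\<xi> w. \<Sum>a\<in>UNIV. (\<xi> $ j $ a *\<^sub>R \<sigma> \<xi> w) \<odot> ocnj (oe a))"
    by (intro has_symbol_sum has_symbol_linear[OF _ omul.bounded_linear_left] has_symbol_pd assms)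
  then show ?thesis
    by (simp add: rdel_def sum_oe_omul)
qed

lemma has_symbol_lbardel:
  assumes "has_symbol \<Omega> k P \<sigma>"
  shows "has_symbol \<Omega> (Suc (Suc k)) (\<lambda>F x. lbardel i j (P F) x)
    (\<lambda>\<xi> w. (\<xi> $ i \<odot> ocnj (\<xi> $ j)) \<odot> \<sigma> \<xi> w)"
proof -
  have "has_symbol \<Omega> (Suc (Suc k))
      (\<lambda>F x. \<Sum>a\<in>UNIV. \<Sum>b\<in>UNIV. (oe a \<odot> ocnj (oe b)) \<odot> pd i a (pd j b (P F)) x)
      (\<lambda>\<xi> w. \<Sum>a\<in>UNIV. \<Sum>b\<in>UNIV. (oe a \<odot> ocnj (oe b)) \<odot> (\<xi> $ i $ a *\<^sub>R \<xi> $ j $ b *\<^sub>R \<sigma> \<xi> w))"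
    by (intro has_symbol_sum has_symbol_linear[OF _ omul.bounded_linear_right] has_symbol_pd assms)
  moreover have "(\<Sum>a\<in>UNIV. \<Sum>b\<in>UNIV. (oe a \<odot> ocnj (oe b)) \<odot> (p $ a *\<^sub>R q $ b *\<^sub>R w))
      = (p \<odot> ocnj q) \<odot> w" for p q w
  proof -
    have "(\<Sum>b\<in>UNIV. (oe a \<odot> ocnj (oe b)) \<odot> (p $ a *\<^sub>R q $ b *\<^sub>R w))
        = ((p $ a *\<^sub>R oe a) \<odot> ocnj q) \<odot> w" for a
      by (subst (2) sum_oe[of q, symmetric])
        (simp add: linear_sum[OF linear_ocnj] linear_cmul[OF linear_ocnj] omul.sum_left omul.sum_right
          omul.scaleR_left omul.scaleR_right mult.commute)
    then show ?thesis
      by (simp flip: omul.sum_left add: sum_oe)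
  qed
  ultimately show ?thesis
    by (simp add: lbardel_def)
qed

lemma has_symbol_lap:
  assumes "has_symbol \<Omega> k P \<sigma>"
  shows "has_symbol \<Omega> (Suc (Suc k)) (\<lambda>F x. lap j (P F) x) (\<lambda>\<xi> w. (\<xi> $ j \<bullet> \<xi> $ j) * \<sigma> \<xi> w)"
proof -
  have "has_symbol \<Omega> (Suc (Suc k)) (\<lambda>F x. \<Sum>a\<in>UNIV. pd j a (pd j a (P F)) x)
      (\<lambda>\<xi> w. \<Sum>a\<in>UNIV. \<xi> $ j $ a *\<^sub>R \<xi> $ j $ a *\<^sub>R \<sigma> \<xi> w)"
    by (intro has_symbol_sum has_symbol_pd assms)
  then show ?thesis
    by (simp add: lap_def inner_vec_def sum_distrib_right mult.assoc)
qed

lemmas has_symbol_intros = has_symbol_vector has_symbol_lbar has_symbol_ldel has_symbol_rbar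
  has_symbol_rdel has_symbol_lbardel has_symbol_lap has_symbol_vec_nth has_symbol_add has_symbol_diff
  has_symbol_linear[OF _ bounded_linear_ocnj] has_symbol_linear[OF _ bounded_linear_oim]
  has_symbol_linear[OF _ bounded_linear_ore] has_symbol_linear[OF _ bounded_linear_oreal]
  has_symbol_linear[OF _ bounded_linear_scaleR_right]
  has_symbol_linear[OF _ bounded_linear_mult_right]
  has_symbol_linear[OF _ bounded_linear_minus[OF bounded_linear_ident]]

text \<open>
  The operators of the complex, applied after an arbitrary \<open>P\<close>; for the composition of two of them
  the rules are chained.
\<close>

lemma has_symbol_D0:
  "has_symbol \<Omega> k P \<sigma> \<Longrightarrow> has_symbol \<Omega> (Suc (Suc k)) (\<lambda>F x. D0 (P F) x) (\<lambda>\<xi> w. symbol_D0 \<xi> (\<sigma> \<xi> w))"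
  unfolding D0_def symbol_D0_def by (intro has_symbol_intros)

lemma has_symbol_D1:
  "has_symbol \<Omega> k P \<sigma> \<Longrightarrow> has_symbol \<Omega> (Suc k) (\<lambda>F x. D1 (P F) x) (\<lambda>\<xi> w. symbol_D1 \<xi> (\<sigma> \<xi> w))"
  unfolding D1_def symbol_D1_def by (intro has_symbol_intros)

lemma has_symbol_D2:
  "has_symbol \<Omega> k P \<sigma> \<Longrightarrow> has_symbol \<Omega> (Suc (Suc k)) (\<lambda>F x. D2 (P F) x) (\<lambda>\<xi> w. symbol_D2 \<xi> (\<sigma> \<xi> w))"
  unfolding D2_def symbol_D2_def by (intro has_symbol_intros)

lemma has_symbol_D3:
  "has_symbol \<Omega> k P \<sigma> \<Longrightarrow> has_symbol \<Omega> (Suc k) (\<lambda>F x. D3 (P F) x) (\<lambda>\<xi> w. symbol_D3 \<xi> (\<sigma> \<xi> w))"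
  unfolding D3_def symbol_D3_def by (intro has_symbol_intros)

lemma has_symbol_D4:
  "has_symbol \<Omega> k P \<sigma> \<Longrightarrow> has_symbol \<Omega> (Suc (Suc k)) (\<lambda>F x. D4 (P F) x) (\<lambda>\<xi> w. symbol_D4 \<xi> (\<sigma> \<xi> w))"
  unfolding D4_def symbol_D4_def by (intro has_symbol_intros)

lemma has_symbol_herm_proj:
  "has_symbol \<Omega> k P \<sigma> \<Longrightarrow> has_symbol \<Omega> k (\<lambda>F x. herm_proj (P F x)) (\<lambda>\<xi> w. herm_proj (\<sigma> \<xi> w))"
  unfolding herm_proj_def by (intro has_symbol_intros)

lemmas has_symbol_of_D = has_symbol_D0[OF has_symbol_id] has_symbol_D1[OF has_symbol_id]
  has_symbol_D2[OF has_symbol_id] has_symbol_D3[OF has_symbol_id] has_symbol_D4[OF has_symbol_id]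

text \<open>
  Smoothness holds for every operator that has a symbol. The value is Hermitian because the operator
  \<open>herm_proj (D0 f) - D0 f\<close> has symbol zero.
\<close>

lemma D0_in_Gam:
  assumes "f \<in> Gam \<Omega> (UNIV :: real set)"
  shows "D0 f \<in> Gam \<Omega> herm2"
proof -
  have f: "smooth_on \<Omega> f"
    using assms by (simp add: Gam_def)
  have "herm_proj (D0 f x) - D0 f x = 0" if "x \<in> \<Omega>" for x
    by (rule has_symbol_0_imp_eq_0[OF has_symbol_diff[OF has_symbol_herm_proj[OF has_symbol_of_D(1)]
            has_symbol_of_D(1)] _ f that]) (simp add: herm_proj_symbol_D0)
  then show ?thesis
    using has_symbol_smooth_on[OF has_symbol_of_D(1) f] by (simp add: Gam_def herm2_iff_herm_proj)
qed

lemma D1_in_Gam: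
  assumes "u \<in> Gam \<Omega> herm2"
  shows "D1 u \<in> Gam \<Omega> UNIV"
  using assms has_symbol_smooth_on[OF has_symbol_of_D(2)] by (simp add: Gam_def)

lemma D2_in_Gam:
  assumes "v \<in> Gam \<Omega> UNIV"
  shows "D2 v \<in> Gam \<Omega> UNIV"
  using assms has_symbol_smooth_on[OF has_symbol_of_D(3)] by (simp add: Gam_def)

lemma D3_in_Gam:
  assumes "t \<in> Gam \<Omega> UNIV"
  shows "D3 t \<in> Gam \<Omega> herm2"
proof -
  have t: "smooth_on \<Omega> t"
    using assms by (simp add: Gam_def)
  have "herm_proj (D3 t x) - D3 t x = 0" if "x \<in> \<Omega>" for x
    by (rule has_symbol_0_imp_eq_0[OF has_symbol_diff[OF has_symbol_herm_proj[OF has_symbol_of_D(4)]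
            has_symbol_of_D(4)] _ t that]) (simp add: herm_proj_symbol_D3)
  then show ?thesis
    using has_symbol_smooth_on[OF has_symbol_of_D(4) t] by (simp add: Gam_def herm2_iff_herm_proj)
qed

lemma D4_in_Gam:
  assumes "s \<in> Gam \<Omega> herm2"
  shows "D4 s \<in> Gam \<Omega> UNIV"
  using assms has_symbol_smooth_on[OF has_symbol_of_D(5)] by (simp add: Gam_def)

lemma D1_D0_eq_0:
  assumes "f \<in> Gam \<Omega> UNIV" "x \<in> \<Omega>"
  shows "D1 (D0 f) x = 0"
  using assms
  by (intro has_symbol_0_imp_eq_0[OF has_symbol_D1[OF has_symbol_of_D(1)] symbol_D1_symbol_D0])
    (simp_all add: Gam_def)

text \<open>
  On \<open>\<Omega>\<close> the function \<open>u\<close> agrees with its Hermitian projection, and differential operators are local.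
  With the projection inserted, the symbol vanishes on all matrices.
\<close>

lemma D2_D1_eq_0:
  assumes "u \<in> Gam \<Omega> herm2" "x \<in> \<Omega>"
  shows "D2 (D1 u) x = 0"
proof -
  have u: "smooth_on \<Omega> u" and herm: "\<And>y. y \<in> \<Omega> \<Longrightarrow> u y = herm_proj (u y)"
    using assms(1) by (simp_all add: Gam_def herm2_iff_herm_proj)
  have "D2 (D1 u) x = D2 (D1 (\<lambda>y. herm_proj (u y))) x"
    by (rule has_symbol_cong_on[OF has_symbol_D2[OF has_symbol_of_D(2)] u herm assms(2)])
  also have "\<dots> = 0"
    by (rule has_symbol_0_imp_eq_0[OF has_symbol_D2[OF has_symbol_D1[OF has_symbol_herm_proj[OF has_symbol_id]]]
          symbol_D2_symbol_D1 u assms(2)])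
  finally show ?thesis .
qed

lemma D3_D2_eq_0:
  assumes "v \<in> Gam \<Omega> UNIV" "x \<in> \<Omega>"
  shows "D3 (D2 v) x = 0"
  using assms
  by (intro has_symbol_0_imp_eq_0[OF has_symbol_D3[OF has_symbol_of_D(3)] symbol_D3_symbol_D2])
    (simp_all add: Gam_def)

lemma D4_D3_eq_0:
  assumes "t \<in> Gam \<Omega> UNIV" "x \<in> \<Omega>"
  shows "D4 (D3 t) x = 0"
  using assms
  by (intro has_symbol_0_imp_eq_0[OF has_symbol_D4[OF has_symbol_of_D(4)] symbol_D4_symbol_D3])
    (simp_all add: Gam_def)

end

theorem proposition3p1:
  fixes \<Omega> :: "(octo ^ 2) set"
  assumes "open \<Omega>" and "connected \<Omega>" and "\<Omega> \<noteq> {}"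
  shows "D0 \<in> Gam \<Omega> (UNIV :: real set) \<rightarrow> Gam \<Omega> herm2
    \<and> D1 \<in> Gam \<Omega> herm2 \<rightarrow> Gam \<Omega> (UNIV :: (octo ^ 2) set)
    \<and> D2 \<in> Gam \<Omega> (UNIV :: (octo ^ 2) set) \<rightarrow> Gam \<Omega> (UNIV :: (octo ^ 2) set)
    \<and> D3 \<in> Gam \<Omega> (UNIV :: (octo ^ 2) set) \<rightarrow> Gam \<Omega> herm2
    \<and> D4 \<in> Gam \<Omega> herm2 \<rightarrow> Gam \<Omega> (UNIV :: real set)
    \<and> (\<forall>f \<in> Gam \<Omega> (UNIV :: real set). \<forall>x\<in>\<Omega>. D1 (D0 f) x = 0)
    \<and> (\<forall>u \<in> Gam \<Omega> herm2. \<forall>x\<in>\<Omega>. D2 (D1 u) x = 0)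
    \<and> (\<forall>v \<in> Gam \<Omega> (UNIV :: (octo ^ 2) set). \<forall>x\<in>\<Omega>. D3 (D2 v) x = 0)
    \<and> (\<forall>t \<in> Gam \<Omega> (UNIV :: (octo ^ 2) set). \<forall>x\<in>\<Omega>. D4 (D3 t) x = 0)"
  by (intro conjI ballI funcsetI)
    (auto intro: D0_in_Gam[OF assms(1)] D1_in_Gam[OF assms(1)] D2_in_Gam[OF assms(1)]
      D3_in_Gam[OF assms(1)] D4_in_Gam[OF assms(1)] D1_D0_eq_0[OF assms(1)] D2_D1_eq_0[OF assms(1)]
      D3_D2_eq_0[OF assms(1)] D4_D3_eq_0[OF assms(1)])

end
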